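(* Let $\mu$ be a log-concave probability measure on $\mathbb{R}^n$ with barycenter at the origin, supported on an open convex set $K\subset\mathbb{R}^n$ with density $e^{-\rho}$ on $K$, where $\rho:K\to\mathbb{R}$ is convex. Assume that $K$ is bounded, that $\rho$ is $C^\infty$-smooth, and that $\rho$ and its derivatives of all orders are bounded in $K$. Then for any $\mu$-integrable, $C^\infty$-smooth function $f:K\to\mathbb{R}$, $$\int_K f^2\,d\mu-\left(\int_K f\,d\mu\right)^2\le 2R^2(K)\int_K|\nabla f|^2\,d\mu,$$ where $R(K)=\sup_{x\in K}|x|$.
   Context: An absolutely continuous probability measure on $\mathbb{R}^n$ is log-concave if it is supported on an open convex set $K\subset\mathbb{R}^n$ and its density there has the form $e^{-\rho}$ with $\rho:K\to\mathbb{R}$ convex. Here $|\cdot|$ is the Euclidean norm; integrals of non-negative functions take values in $[0,+\infty]$. *)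

theory Defs
  imports "HOL-Analysis.Analysis" "HOL-Probability.Probability_Measure"
begin

definition log_concave_with ::
  "(real ^ 'n) measure \<Rightarrow> (real ^ 'n) set \<Rightarrow> (real ^ 'n \<Rightarrow> real) \<Rightarrow> bool"
  where "log_concave_with \<mu> K \<rho> \<longleftrightarrow>
    open K \<and> convex K \<and> convex_on K \<rho> \<and> prob_space \<mu> \<and>
    \<mu> = density lborel (\<lambda>x. ennreal (exp (- \<rho> x)) * indicator K x)"

definition barycenter :: "(real ^ 'n) measure \<Rightarrow> real ^ 'n"
  where "barycenter \<mu> = (LINT x|\<mu>. x)"

text \<open>Functions on an open set \<open>K\<close> are total functions whose values off \<open>K\<close> are irrelevant:
  the derivatives below are only ever evaluated at points of \<open>K\<close>, where they depend on the
  germ of the function alone.\<close>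

definition partial_deriv :: "'n \<Rightarrow> (real ^ 'n \<Rightarrow> real) \<Rightarrow> real ^ 'n \<Rightarrow> real"
  where "partial_deriv i f x = frechet_derivative f (at x) (axis i 1)"

text \<open>The list \<open>is\<close> plays the role of a multi-index; its length is the order of the derivative.\<close>

definition iter_partial_deriv :: "'n list \<Rightarrow> (real ^ 'n \<Rightarrow> real) \<Rightarrow> real ^ 'n \<Rightarrow> real"
  where "iter_partial_deriv is f = foldr partial_deriv is f"

text \<open>Differentiability (hence continuity) of every iterated partial derivative, including
  \<open>f\<close> itself, is the \<open>C\<close>-infinity property on an open set.\<close>

definition smooth_on :: "(real ^ 'n) set \<Rightarrow> (real ^ 'n \<Rightarrow> real) \<Rightarrow> bool"
  where "smooth_on K f \<longleftrightarrow> (\<forall>is. iter_partial_deriv is f differentiable_on K)"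

text \<open>The order-zero case \<open>is = []\<close> is boundedness of \<open>f\<close> itself.\<close>

definition bounded_derivs_on :: "(real ^ 'n) set \<Rightarrow> (real ^ 'n \<Rightarrow> real) \<Rightarrow> bool"
  where "bounded_derivs_on K f \<longleftrightarrow> (\<forall>is. bounded (iter_partial_deriv is f ` K))"

definition gradient :: "(real ^ 'n \<Rightarrow> real) \<Rightarrow> real ^ 'n \<Rightarrow> real ^ 'n"
  where "gradient f x = (THE D. GDERIV f x :> D)"

end

theory Submission
  imports Defs
begin

text \<open>
  The constant \<open>2 R\<^sup>2\<close> leaves room for a perturbation argument. Multiply the density
  \<open>exp (- \<rho>)\<close> by the Gaussian factor \<open>exp (- norm x\<^sup>2 / (2 R\<^sup>2))\<close>. The new weight
  is log-concave with modulus of convexity \<open>1 / R\<^sup>2\<close>, so it has a Poincare inequality with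
  constant \<open>R\<^sup>2\<close>. On the ball of radius \<open>R\<close> the factor lies between \<open>exp (- 1/2)\<close>
  and \<open>1\<close>; removing it therefore costs at most \<open>exp (1/2) < 2\<close> (the Holley-Stroock
  argument, \<open>poincare_log_concave_compact\<close>).

  The Poincare inequality for uniformly convex potentials \<open>V\<close> is derived from the
  Prekopa-Leindler inequality by Maurey's method (\<open>poincare_strongly_log_concave\<close>). Apply
  Prekopa-Leindler at midpoints to the three functions
  \<open>exp (- V + e f - e\<^sup>2 g)\<close>, \<open>exp (- V - e f)\<close> and \<open>exp (- V)\<close>, where
  \<open>g\<close> is a multiple of the squared gradient of \<open>f\<close>. A difference
  \<open>e (f x - f y)\<close> is to first order at most \<open>e\<close> times \<open>norm (gradient f x) * norm (x - y)\<close>;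
  the uniform convexity of \<open>V\<close> absorbs the factor \<open>norm (x - y)\<close> at the price
  \<open>e\<^sup>2 g x\<close>. The resulting inequality between exponential integrals is an equality at
  \<open>e = 0\<close>, its terms of order \<open>e\<close> cancel, and the terms of order \<open>e\<^sup>2\<close>
  are the Poincare inequality.

  The Prekopa-Leindler inequality itself goes by induction on the dimension: integrating out one
  coordinate preserves the hypothesis, and on the line it follows from
  \<open>\<bar>A\<bar> + \<bar>B\<bar> \<le> \<bar>A + B\<bar>\<close> applied to superlevel sets.

  These arguments need bounds on \<open>f\<close> and its derivatives, which are available on compact convex
  subsets of \<open>K\<close>. The set \<open>K\<close> is exhausted by such subsets, its erosions. In the limit the
  integral of \<open>f\<^sup>2\<close> is controlled by monotone convergence, so the square integrability of
  \<open>f\<close> is part of the conclusion.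
\<close>

section \<open>The Prekopa-Leindler inequality on the line\<close>

lemma emeasure_lborel_doubling_preimage:
  fixes S :: "real set"
  assumes "S \<in> sets borel"
  shows "emeasure lborel S = 2 * emeasure lborel {z. 2 * z - b \<in> S}"
proof -
  have [measurable]: "S \<in> sets borel" by fact
  have "emeasure lborel S = (\<integral>\<^sup>+x. indicator S x \<partial>lborel)"
    by simp
  also have "\<dots> = 2 * (\<integral>\<^sup>+x. indicator S (- b + 2 * x) \<partial>lborel)"
    by (subst nn_integral_real_affine[where c = 2 and t = "- b"]) auto
  also have "(\<integral>\<^sup>+x. indicator S (- b + 2 * x) \<partial>lborel)
      = (\<integral>\<^sup>+x. indicator {z. 2 * z - b \<in> S} x \<partial>lborel)"
    by (intro nn_integral_cong) (auto simp: indicator_def add.commute)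
  also have "\<dots> = emeasure lborel {z. 2 * z - b \<in> S}"
    by (intro nn_integral_indicator) measurable
  finally show ?thesis .
qed

text \<open>Take \<open>a \<in> A\<close> close to the supremum of \<open>A\<close> and \<open>b \<in> B\<close> close to the infimum of
  \<open>B\<close>. Up to a small error, \<open>A\<close> lies to the left of \<open>a\<close> and \<open>B\<close> to the right of
  \<open>b\<close>. The midpoints of \<open>A\<close> with \<open>b\<close> and of \<open>B\<close> with \<open>a\<close> then fill
  disjoint parts of \<open>C\<close>, separated by the midpoint of \<open>a\<close> and \<open>b\<close>.\<close>

lemma midpoint_brunn_minkowski_bounded:
  fixes A B C :: "real set"
  assumes [measurable]: "A \<in> sets borel" "B \<in> sets borel" "C \<in> sets borel"
    and ne: "A \<noteq> {}" "B \<noteq> {}" and bdd: "bdd_above A" "bdd_below B"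
    and mid: "\<And>a b. a \<in> A \<Longrightarrow> b \<in> B \<Longrightarrow> (a + b) / 2 \<in> C"
  shows "emeasure lborel A + emeasure lborel B \<le> 2 * emeasure lborel C"
proof (rule ennreal_le_epsilon)
  fix e :: real
  assume e: "0 < e"
  obtain a where a: "a \<in> A" "Sup A - e / 2 < a"
    using less_cSupE[of "Sup A - e / 2" A] ne e by (metis diff_less_eq half_gt_zero less_add_same_cancel1)
  obtain b where b: "b \<in> B" "b < Inf B + e / 2"
    using cInf_lessD[of B "Inf B + e / 2"] ne e by auto
  define m where "m = (a + b) / 2"
  have A: "emeasure lborel A \<le> emeasure lborel (A \<inter> {..a}) + ennreal (e / 2)"
  proof -
    have "x \<le> a + e / 2" if "x \<in> A" for x
      using cSup_upper[OF that bdd(1)] a(2) by linarith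
    then have "A \<subseteq> (A \<inter> {..a}) \<union> {a..a + e / 2}" by fastforce
    then have "emeasure lborel A \<le> emeasure lborel ((A \<inter> {..a}) \<union> {a..a + e / 2})"
      by (intro emeasure_mono) auto
    also have "\<dots> \<le> emeasure lborel (A \<inter> {..a}) + emeasure lborel {a..a + e / 2}"
      by (intro emeasure_subadditive) auto
    finally show ?thesis using e by simp
  qed
  have B: "emeasure lborel B \<le> emeasure lborel (B \<inter> {b<..}) + ennreal (e / 2)"
  proof -
    have "b - e / 2 \<le> x" if "x \<in> B" for x
      using cInf_lower[OF that bdd(2)] b(2) by linarith
    then have "B \<subseteq> (B \<inter> {b<..}) \<union> {b - e / 2..b}" by fastforce
    then have "emeasure lborel B \<le> emeasure lborel ((B \<inter> {b<..}) \<union> {b - e / 2..b})"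
      by (intro emeasure_mono) auto
    also have "\<dots> \<le> emeasure lborel (B \<inter> {b<..}) + emeasure lborel {b - e / 2..b}"
      by (intro emeasure_subadditive) auto
    finally show ?thesis using e by simp
  qed
  have "emeasure lborel (A \<inter> {..a}) \<le> 2 * emeasure lborel (C \<inter> {..m})"
  proof -
    have "{z. 2 * z - b \<in> A \<inter> {..a}} \<subseteq> C \<inter> {..m}"
      using mid b(1) by (fastforce simp: m_def)
    then show ?thesis
      unfolding emeasure_lborel_doubling_preimage[of "A \<inter> {..a}" b, simplified]
      by (intro mult_left_mono emeasure_mono) auto
  qed
  moreover have "emeasure lborel (B \<inter> {b<..}) \<le> 2 * emeasure lborel (C \<inter> {m<..})"
  proof -
    have "{z. 2 * z - a \<in> B \<inter> {b<..}} \<subseteq> C \<inter> {m<..}"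
      using mid a(1) by (fastforce simp: m_def)
    then show ?thesis
      unfolding emeasure_lborel_doubling_preimage[of "B \<inter> {b<..}" a, simplified]
      by (intro mult_left_mono emeasure_mono) auto
  qed
  moreover have "emeasure lborel (C \<inter> {..m}) + emeasure lborel (C \<inter> {m<..}) = emeasure lborel C"
    by (subst plus_emeasure) (auto intro!: arg_cong[where f = "emeasure lborel"])
  ultimately have "emeasure lborel (A \<inter> {..a}) + emeasure lborel (B \<inter> {b<..})
      \<le> 2 * emeasure lborel C"
    by (metis add_mono distrib_left)
  then have "(emeasure lborel (A \<inter> {..a}) + emeasure lborel (B \<inter> {b<..}))
      + (ennreal (e / 2) + ennreal (e / 2)) \<le> 2 * emeasure lborel C + ennreal e"
    using e by (intro add_mono) (auto simp flip: ennreal_plus)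
  then show "emeasure lborel A + emeasure lborel B \<le> 2 * emeasure lborel C + ennreal e"
    using add_mono[OF A B] by (simp add: ac_simps)
qed

lemma midpoint_brunn_minkowski:
  fixes A B C :: "real set"
  assumes [measurable]: "A \<in> sets borel" "B \<in> sets borel" "C \<in> sets borel"
    and ne: "A \<noteq> {}" "B \<noteq> {}"
    and mid: "\<And>a b. a \<in> A \<Longrightarrow> b \<in> B \<Longrightarrow> (a + b) / 2 \<in> C"
  shows "emeasure lborel A + emeasure lborel B \<le> 2 * emeasure lborel C"
proof -
  define A' B' where "A' n = A \<inter> {..real n}" and "B' n = B \<inter> {- real n..}" for n
  have m[measurable]: "A' n \<in> sets borel" "B' n \<in> sets borel" for n
    by (auto simp: A'_def B'_def)
  have "incseq A'" "incseq B'" by (auto simp: incseq_def A'_def B'_def)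
  moreover have "(\<Union>n. A' n) = A" "(\<Union>n. B' n) = B"
    using real_arch_simple
    by (auto simp: A'_def B'_def) (metis minus_le_iff real_arch_simple)
  ultimately have "(\<lambda>n. emeasure lborel (A' n)) \<longlonglongrightarrow> emeasure lborel A"
      "(\<lambda>n. emeasure lborel (B' n)) \<longlonglongrightarrow> emeasure lborel B"
    using Lim_emeasure_incseq[of A' lborel] Lim_emeasure_incseq[of B' lborel] m
    by (auto simp: image_subset_iff)
  then have lim: "(\<lambda>n. emeasure lborel (A' n) + emeasure lborel (B' n))
      \<longlonglongrightarrow> emeasure lborel A + emeasure lborel B"
    by (rule tendsto_add)
  obtain a b where ab: "a \<in> A" "b \<in> B" using ne by auto
  obtain N where N: "\<bar>a\<bar> + \<bar>b\<bar> \<le> real N" using real_arch_simple by blast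
  have "emeasure lborel (A' n) + emeasure lborel (B' n) \<le> 2 * emeasure lborel C" if "n \<ge> N" for n
  proof (rule midpoint_brunn_minkowski_bounded)
    have "\<bar>a\<bar> + \<bar>b\<bar> \<le> real n" using N that by linarith
    then have "a \<in> A' n" "b \<in> B' n" using ab by (auto simp: A'_def B'_def)
    then show "A' n \<noteq> {}" "B' n \<noteq> {}" by auto
    show "bdd_above (A' n)" "bdd_below (B' n)" by (auto simp: A'_def B'_def)
  qed (use mid in \<open>auto simp: A'_def B'_def\<close>)
  then show ?thesis
    by (intro LIMSEQ_le_const2[OF lim]) auto
qed

text \<open>The layer cake formula cut off at height \<open>1\<close>. The cut-off lets the same formula serve for
  functions with supremum \<open>1\<close> and, as a lower bound, for the third function in
  Prekopa-Leindler.\<close>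

lemma nn_integral_layer_cake:
  fixes w :: "'a \<Rightarrow> ennreal"
  assumes [measurable]: "w \<in> borel_measurable M" and "sigma_finite_measure M"
  shows "(\<integral>\<^sup>+x. min (w x) 1 \<partial>M)
    = (\<integral>\<^sup>+t. emeasure M {x \<in> space M. ennreal t < w x} * indicator {0..<1} t \<partial>lborel)"
proof -
  interpret sigma_finite_measure M by fact
  interpret pair_sigma_finite M "lborel :: real measure" ..
  define g :: "'a \<Rightarrow> real \<Rightarrow> ennreal"
    where "g x t = (if 0 \<le> t \<and> t < 1 \<and> ennreal t < w x then 1 else 0)" for x t
  have [measurable]: "case_prod g \<in> borel_measurable (M \<Otimes>\<^sub>M lborel)"
    unfolding g_def by measurable
  have layer: "(\<integral>\<^sup>+t. g x t \<partial>lborel) = min (w x) 1" for x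
  proof (cases "w x < 1")
    case True
    then obtain r where r: "w x = ennreal r" "0 \<le> r"
      by (cases "w x") auto
    then have "g x = indicator {0..<r}"
      using True by (auto simp: g_def fun_eq_iff ennreal_less_iff indicator_def)
    then show ?thesis using r True by simp
  next
    case False
    have "ennreal t < w x" if "0 \<le> t" "t < 1" for t
      using that False by (metis ennreal_1 ennreal_less_iff leI less_le_trans)
    then have "g x = indicator {0..<1}" by (auto simp: g_def fun_eq_iff indicator_def)
    then show ?thesis using False by (simp add: min_def not_less)
  qed
  have "(\<integral>\<^sup>+x. min (w x) 1 \<partial>M) = (\<integral>\<^sup>+x. (\<integral>\<^sup>+t. g x t \<partial>lborel) \<partial>M)"
    unfolding layer ..
  also have "\<dots> = (\<integral>\<^sup>+t. (\<integral>\<^sup>+x. g x t \<partial>M) \<partial>lborel)"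
    by (rule Fubini'[symmetric]) measurable
  also have "\<dots> = (\<integral>\<^sup>+t. emeasure M {x \<in> space M. ennreal t < w x} * indicator {0..<1} t \<partial>lborel)"
  proof (intro nn_integral_cong)
    fix t :: real
    have "(\<integral>\<^sup>+x. g x t \<partial>M)
        = (\<integral>\<^sup>+x. indicator {x \<in> space M. ennreal t < w x} x * indicator {0..<1} t \<partial>M)"
      by (intro nn_integral_cong) (auto simp: indicator_def g_def)
    also have "\<dots> = emeasure M {x \<in> space M. ennreal t < w x} * indicator {0..<1} t"
      by (subst nn_integral_multc) auto
    finally show "(\<integral>\<^sup>+x. g x t \<partial>M) = emeasure M {x \<in> space M. ennreal t < w x} * indicator {0..<1} t" .
  qed
  finally show ?thesis .
qed

text \<open>When both suprema are \<open>1\<close>, the superlevel sets of \<open>U\<close> and \<open>V\<close> at each height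
  \<open>t < 1\<close> are nonempty and their midpoints lie in the superlevel set of \<open>H\<close>; the
  inequality for sets is integrated over \<open>t\<close>. The common supremum is what makes the arithmetic
  mean available here instead of the geometric one.\<close>

lemma prekopa_leindler_real_normalized:
  fixes U V H :: "real \<Rightarrow> ennreal"
  assumes [measurable]: "U \<in> borel_measurable borel" "V \<in> borel_measurable borel"
      "H \<in> borel_measurable borel"
    and sup: "(SUP x. U x) = 1" "(SUP x. V x) = 1"
    and mid: "\<And>x y. U x * V y \<le> (H ((x + y) / 2))\<^sup>2"
  shows "(\<integral>\<^sup>+x. U x \<partial>lborel) + (\<integral>\<^sup>+x. V x \<partial>lborel) \<le> 2 * (\<integral>\<^sup>+x. H x \<partial>lborel)"
proof -
  have U1: "U x \<le> 1" and V1: "V x \<le> 1" for x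
    using sup by (metis SUP_upper UNIV_I)+
  have cake: "(\<integral>\<^sup>+x. min (w x) 1 \<partial>lborel)
      = (\<integral>\<^sup>+t. emeasure lborel {x. ennreal t < w x} * indicator {0..<1} t \<partial>lborel)"
    if "w \<in> borel_measurable borel" for w :: "real \<Rightarrow> ennreal"
    using nn_integral_layer_cake[of w lborel] that lborel.sigma_finite_measure_axioms by simp
  have lmeas[measurable]: "(\<lambda>t. emeasure lborel {x. ennreal t < w x}) \<in> borel_measurable borel"
    if [measurable]: "w \<in> borel_measurable borel" for w :: "real \<Rightarrow> ennreal"
    by measurable
  have le: "emeasure lborel {x. ennreal t < U x} + emeasure lborel {x. ennreal t < V x}
      \<le> 2 * emeasure lborel {x. ennreal t < H x}" if t: "0 \<le> t" "t < 1" for t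
  proof (rule midpoint_brunn_minkowski)
    have "ennreal t < (SUP x. U x)" "ennreal t < (SUP x. V x)"
      using t sup by (auto simp: ennreal_less_one_iff)
    then show "{x. ennreal t < U x} \<noteq> {}" "{x. ennreal t < V x} \<noteq> {}"
      by (auto simp: less_SUP_iff)
    fix x y assume "x \<in> {x. ennreal t < U x}" "y \<in> {x. ennreal t < V x}"
    then have xy: "ennreal t < U x" "ennreal t < V y" by auto
    obtain u v where uv: "U x = ennreal u" "0 \<le> u" "V y = ennreal v" "0 \<le> v"
      using U1[of x] V1[of y] by (cases "U x"; cases "V y") (auto simp: top_unique)
    have "ennreal t < H ((x + y) / 2)"
    proof (rule ccontr)
      assume "\<not> ?thesis"
      then have "(H ((x + y) / 2))\<^sup>2 \<le> (ennreal t)\<^sup>2"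
        by (intro power_mono) auto
      then have "ennreal u * ennreal v \<le> (ennreal t)\<^sup>2"
        using mid[of x y] uv by auto
      then have "u * v \<le> t * t"
        using uv t by (simp flip: ennreal_mult add: power2_eq_square)
      moreover have "t * t < u * v"
        using xy uv t by (intro mult_strict_mono') (auto simp: ennreal_less_iff)
      ultimately show False by simp
    qed
    then show "(x + y) / 2 \<in> {x. ennreal t < H x}" by simp
  qed measurable
  have "(\<integral>\<^sup>+x. U x \<partial>lborel) + (\<integral>\<^sup>+x. V x \<partial>lborel)
      = (\<integral>\<^sup>+x. min (U x) 1 \<partial>lborel) + (\<integral>\<^sup>+x. min (V x) 1 \<partial>lborel)"
    using U1 V1 by (simp add: min_absorb1)
  also have "\<dots> = (\<integral>\<^sup>+t. emeasure lborel {x. ennreal t < U x} * indicator {0..<1} t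
      + emeasure lborel {x. ennreal t < V x} * indicator {0..<1} t \<partial>lborel)"
    by (subst (1 2) cake) (auto simp: nn_integral_add)
  also have "\<dots> \<le> (\<integral>\<^sup>+t. 2 * (emeasure lborel {x. ennreal t < H x} * indicator {0..<1} t) \<partial>lborel)"
    using le by (intro nn_integral_mono) (auto simp: indicator_def)
  also have "\<dots> = 2 * (\<integral>\<^sup>+x. min (H x) 1 \<partial>lborel)"
    by (subst nn_integral_cmult) (auto simp: cake)
  also have "\<dots> \<le> 2 * (\<integral>\<^sup>+x. H x \<partial>lborel)"
    by (intro mult_left_mono nn_integral_mono) auto
  finally show ?thesis .
qed

lemma ennreal_mult_le_square:
  fixes X Y Z :: ennreal
  assumes "X + Y \<le> 2 * Z"
  shows "X * Y \<le> Z\<^sup>2"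
proof (cases "Z = top")
  case True
  then show ?thesis by simp
next
  case False
  then obtain z where z: "Z = ennreal z" "0 \<le> z" by (cases Z) auto
  have "X + Y \<noteq> top" using assms z
    by (metis ennreal_mult_eq_top_iff ennreal_neq_top ennreal_numeral top.extremum_unique)
  then obtain x y where xy: "X = ennreal x" "0 \<le> x" "Y = ennreal y" "0 \<le> y"
    by (cases X; cases Y) auto
  have "x + y \<le> 2 * z"
    using assms xy z by (simp flip: ennreal_plus ennreal_mult'' ennreal_numeral)
  then have "(x + y)\<^sup>2 \<le> (2 * z)\<^sup>2" using xy by (intro power_mono) auto
  moreover have "4 * (x * y) \<le> (x + y)\<^sup>2"
    using zero_le_power2[of "x - y"] by (simp add: power2_eq_square algebra_simps)
  ultimately have "x * y \<le> z\<^sup>2" by (simp add: power_mult_distrib)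
  then show ?thesis using xy z by (simp flip: ennreal_mult add: ennreal_power)
qed

text \<open>Dividing \<open>U\<close>, \<open>V\<close> and \<open>H\<close> by \<open>a\<close>, \<open>b\<close> and \<open>sqrt (a * b)\<close>, with
  \<open>a\<close> and \<open>b\<close> the suprema of \<open>U\<close> and \<open>V\<close>, reduces to the normalized case;
  the inequality between arithmetic and geometric mean turns the sum into a product.\<close>

lemma prekopa_leindler_real_bounded:
  fixes U V H :: "real \<Rightarrow> ennreal"
  assumes [measurable]: "U \<in> borel_measurable borel" "V \<in> borel_measurable borel"
      "H \<in> borel_measurable borel"
    and sup: "(SUP x. U x) < top" "(SUP x. V x) < top"
    and mid: "\<And>x y. U x * V y \<le> (H ((x + y) / 2))\<^sup>2"
  shows "(\<integral>\<^sup>+x. U x \<partial>lborel) * (\<integral>\<^sup>+x. V x \<partial>lborel) \<le> (\<integral>\<^sup>+x. H x \<partial>lborel)\<^sup>2"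
proof (cases "(SUP x. U x) = 0 \<or> (SUP x. V x) = 0")
  case True
  then have "(\<forall>x. U x = 0) \<or> (\<forall>x. V x = 0)"
    by (metis SUP_upper UNIV_I le_zero_eq)
  then show ?thesis by auto
next
  case False
  with sup obtain a b where ab: "(SUP x. U x) = ennreal a" "(SUP x. V x) = ennreal b" "0 < a" "0 < b"
    by (cases "SUP x. U x"; cases "SUP x. V x") (auto simp: less_le)
  define c where "c = sqrt (1 / a * (1 / b))"
  have c2: "(ennreal c)\<^sup>2 = ennreal (1 / a) * ennreal (1 / b)" "0 < c"
    using ab by (auto simp: c_def ennreal_power ennreal_mult[symmetric])
  have "(\<integral>\<^sup>+x. U x * ennreal (1 / a) \<partial>lborel) + (\<integral>\<^sup>+x. V x * ennreal (1 / b) \<partial>lborel)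
      \<le> 2 * (\<integral>\<^sup>+x. H x * ennreal c \<partial>lborel)"
  proof (rule prekopa_leindler_real_normalized)
    show "(SUP x. U x * ennreal (1 / a)) = 1" "(SUP x. V x * ennreal (1 / b)) = 1"
      using ab by (auto simp flip: SUP_mult_right_ennreal ennreal_mult)
    fix x y
    have "U x * ennreal (1 / a) * (V y * ennreal (1 / b)) = U x * V y * (ennreal c)\<^sup>2"
      by (simp add: c2 ac_simps)
    also have "\<dots> \<le> (H ((x + y) / 2))\<^sup>2 * (ennreal c)\<^sup>2"
      by (intro mult_right_mono mid) auto
    finally show "U x * ennreal (1 / a) * (V y * ennreal (1 / b)) \<le> (H ((x + y) / 2) * ennreal c)\<^sup>2"
      by (simp add: power_mult_distrib)
  qed measurable
  then have "(\<integral>\<^sup>+x. U x * ennreal (1 / a) \<partial>lborel) * (\<integral>\<^sup>+x. V x * ennreal (1 / b) \<partial>lborel)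
      \<le> (\<integral>\<^sup>+x. H x * ennreal c \<partial>lborel)\<^sup>2"
    by (rule ennreal_mult_le_square)
  then have "(\<integral>\<^sup>+x. U x \<partial>lborel) * (\<integral>\<^sup>+x. V x \<partial>lborel) * (ennreal c)\<^sup>2
      \<le> (\<integral>\<^sup>+x. H x \<partial>lborel)\<^sup>2 * (ennreal c)\<^sup>2"
    by (simp add: nn_integral_multc nn_integral_cmult power_mult_distrib c2(1) ac_simps)
  then have "(\<integral>\<^sup>+x. U x \<partial>lborel) * (\<integral>\<^sup>+x. V x \<partial>lborel) * (ennreal c)\<^sup>2 * (ennreal (1 / c))\<^sup>2
      \<le> (\<integral>\<^sup>+x. H x \<partial>lborel)\<^sup>2 * (ennreal c)\<^sup>2 * (ennreal (1 / c))\<^sup>2"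
    by (rule mult_right_mono) simp
  moreover have cancel: "(ennreal c)\<^sup>2 * (ennreal (1 / c))\<^sup>2 = 1"
    using c2(2) by (simp add: ennreal_power flip: ennreal_mult power_mult_distrib)
  ultimately show ?thesis by (simp only: mult.assoc cancel mult_1_right)
qed

lemma SUP_min_of_nat_ennreal: "(SUP n. min u (of_nat n)) = (u :: ennreal)"
proof -
  have "(SUP n. min u (of_nat n)) = inf u (SUP n. of_nat n)"
    by (subst inf_SUP) (simp add: inf_min)
  then show ?thesis by (simp add: ennreal_SUP_of_nat_eq_top)
qed

lemma nn_integral_eq_SUP_truncation:
  assumes [measurable]: "u \<in> borel_measurable M"
  shows "(\<integral>\<^sup>+x. u x \<partial>M) = (SUP n. \<integral>\<^sup>+x. min (u x) (of_nat n) \<partial>M)"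
proof -
  have "(\<integral>\<^sup>+x. u x \<partial>M) = (\<integral>\<^sup>+x. (SUP n. min (u x) (of_nat n)) \<partial>M)"
    by (simp add: SUP_min_of_nat_ennreal)
  also have "\<dots> = (SUP n. \<integral>\<^sup>+x. min (u x) (of_nat n) \<partial>M)"
    by (intro nn_integral_monotone_convergence_SUP)
      (auto simp: incseq_def le_fun_def min_le_iff_disj intro: order_trans)
  finally show ?thesis .
qed

text \<open>Truncating \<open>U\<close> and \<open>V\<close> preserves the hypothesis. Using two independent truncation
  levels makes the passage to the limit a pair of suprema.\<close>

lemma prekopa_leindler_real:
  fixes U V H :: "real \<Rightarrow> ennreal"
  assumes [measurable]: "U \<in> borel_measurable borel" "V \<in> borel_measurable borel"
      "H \<in> borel_measurable borel"
    and mid: "\<And>x y. U x * V y \<le> (H ((x + y) / 2))\<^sup>2"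
  shows "(\<integral>\<^sup>+x. U x \<partial>lborel) * (\<integral>\<^sup>+x. V x \<partial>lborel) \<le> (\<integral>\<^sup>+x. H x \<partial>lborel)\<^sup>2"
proof -
  have "(\<integral>\<^sup>+x. min (U x) (of_nat n) \<partial>lborel) * (\<integral>\<^sup>+x. min (V x) (of_nat m) \<partial>lborel)
      \<le> (\<integral>\<^sup>+x. H x \<partial>lborel)\<^sup>2" for n m
  proof (rule prekopa_leindler_real_bounded)
    have "(SUP x. min (U x) (of_nat n)) \<le> of_nat n" "(SUP x. min (V x) (of_nat m)) \<le> of_nat m"
      by (auto intro: SUP_least)
    then show "(SUP x. min (U x) (of_nat n)) < top" "(SUP x. min (V x) (of_nat m)) < top"
      by (auto intro: le_less_trans simp: of_nat_less_top)
    show "min (U x) (of_nat n) * min (V y) (of_nat m) \<le> (H ((x + y) / 2))\<^sup>2" for x y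
      by (intro order_trans[OF mult_mono mid]) auto
  qed measurable
  then show ?thesis
    by (simp add: nn_integral_eq_SUP_truncation[of U] nn_integral_eq_SUP_truncation[of V]
        SUP_mult_left_ennreal SUP_mult_right_ennreal SUP_le_iff)
qed

section \<open>The Prekopa-Leindler inequality in Euclidean space\<close>

text \<open>In the induction step, the partial integrals over the coordinates in \<open>I\<close>, as functions of
  the new coordinate, satisfy the one-dimensional hypothesis: this is the induction hypothesis,
  applied to the sections of \<open>u\<close>, \<open>v\<close>, \<open>h\<close> at \<open>s\<close>, \<open>t\<close> and
  \<open>(s + t) / 2\<close>.\<close>

lemma prekopa_leindler_PiM:
  fixes u v h :: "('i \<Rightarrow> real) \<Rightarrow> ennreal"
  assumes "finite I"
    and "u \<in> borel_measurable (Pi\<^sub>M I (\<lambda>_. lborel))"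
      "v \<in> borel_measurable (Pi\<^sub>M I (\<lambda>_. lborel))"
      "h \<in> borel_measurable (Pi\<^sub>M I (\<lambda>_. lborel))"
    and "\<And>x y. x \<in> extensional I \<Longrightarrow> y \<in> extensional I \<Longrightarrow>
        u x * v y \<le> (h (\<lambda>i\<in>I. (x i + y i) / 2))\<^sup>2"
  shows "(\<integral>\<^sup>+x. u x \<partial>Pi\<^sub>M I (\<lambda>_. lborel)) * (\<integral>\<^sup>+x. v x \<partial>Pi\<^sub>M I (\<lambda>_. lborel))
      \<le> (\<integral>\<^sup>+x. h x \<partial>Pi\<^sub>M I (\<lambda>_. lborel))\<^sup>2"
  using assms
proof (induction I arbitrary: u v h rule: finite_induct)
  case empty
  interpret product_sigma_finite "\<lambda>_. lborel :: real measure" ..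
  show ?case
    using empty(4)[of "\<lambda>_. undefined" "\<lambda>_. undefined"]
    by (simp add: nn_integral_empty restrict_def)
next
  case (insert i I)
  interpret product_sigma_finite "\<lambda>_. lborel :: real measure" ..
  interpret fin: finite_product_sigma_finite "\<lambda>_. lborel :: real measure" I
    by standard (fact insert)
  note [measurable] = insert.prems(1-3)
  have section_meas[measurable]:
    "(\<lambda>(t, x). w (x(i := t))) \<in> borel_measurable (lborel \<Otimes>\<^sub>M Pi\<^sub>M I (\<lambda>_. lborel))"
    if [measurable]: "w \<in> borel_measurable (Pi\<^sub>M (insert i I) (\<lambda>_. lborel))"
    for w :: "('i \<Rightarrow> real) \<Rightarrow> ennreal"
    by measurable
  define J where "J w t = (\<integral>\<^sup>+x. w (x(i := t)) \<partial>Pi\<^sub>M I (\<lambda>_. lborel))"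
    for w :: "('i \<Rightarrow> real) \<Rightarrow> ennreal" and t
  have split: "(\<integral>\<^sup>+x. w x \<partial>Pi\<^sub>M (insert i I) (\<lambda>_. lborel)) = (\<integral>\<^sup>+t. J w t \<partial>lborel)"
    if "w \<in> borel_measurable (Pi\<^sub>M (insert i I) (\<lambda>_. lborel))" for w
    unfolding J_def by (rule product_nn_integral_insert_rev[OF insert.hyps that])
  have J_meas[measurable]: "J w \<in> borel_measurable borel"
    if [measurable]: "w \<in> borel_measurable (Pi\<^sub>M (insert i I) (\<lambda>_. lborel))" for w
    using fin.borel_measurable_nn_integral[OF section_meas[OF that]]
    by (simp add: J_def[abs_def])
  have "(\<integral>\<^sup>+t. J u t \<partial>lborel) * (\<integral>\<^sup>+t. J v t \<partial>lborel) \<le> (\<integral>\<^sup>+t. J h t \<partial>lborel)\<^sup>2"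
  proof (rule prekopa_leindler_real)
    fix s t :: real
    show "J u s * J v t \<le> (J h ((s + t) / 2))\<^sup>2"
      unfolding J_def
    proof (rule insert.IH)
      fix x y :: "'i \<Rightarrow> real"
      assume xy: "x \<in> extensional I" "y \<in> extensional I"
      have "(\<lambda>j\<in>insert i I. ((x(i := s)) j + (y(i := t)) j) / 2)
          = (\<lambda>j\<in>I. (x j + y j) / 2)(i := (s + t) / 2)"
        using insert.hyps by (auto simp: fun_eq_iff restrict_def)
      moreover have "x(i := s) \<in> extensional (insert i I)" "y(i := t) \<in> extensional (insert i I)"
        using xy by (auto simp: extensional_def)
      ultimately show "u (x(i := s)) * v (y(i := t))
          \<le> (h ((\<lambda>j\<in>I. (x j + y j) / 2)(i := (s + t) / 2)))\<^sup>2"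
        using insert.prems(4) by metis
    qed measurable
  qed measurable
  then show ?case by (simp add: split)
qed

theorem prekopa_leindler_midpoint:
  fixes u v h :: "'a::euclidean_space \<Rightarrow> ennreal"
  assumes [measurable]: "u \<in> borel_measurable borel" "v \<in> borel_measurable borel"
      "h \<in> borel_measurable borel"
    and mid: "\<And>x y. u x * v y \<le> (h ((1/2) *\<^sub>R (x + y)))\<^sup>2"
  shows "(\<integral>\<^sup>+x. u x \<partial>lborel) * (\<integral>\<^sup>+x. v x \<partial>lborel) \<le> (\<integral>\<^sup>+x. h x \<partial>lborel)\<^sup>2"
proof -
  define T :: "('a \<Rightarrow> real) \<Rightarrow> 'a" where "T f = (\<Sum>b\<in>Basis. f b *\<^sub>R b)" for f
  have [measurable]: "T \<in> borel_measurable (Pi\<^sub>M Basis (\<lambda>_. lborel))"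
    unfolding T_def by measurable
  have push: "(\<integral>\<^sup>+x. w x \<partial>lborel) = (\<integral>\<^sup>+f. w (T f) \<partial>Pi\<^sub>M Basis (\<lambda>_. lborel))"
    if [measurable]: "w \<in> borel_measurable borel" for w :: "'a \<Rightarrow> ennreal"
    by (subst lborel_eq) (simp add: nn_integral_distr T_def[symmetric])
  have "(\<integral>\<^sup>+f. u (T f) \<partial>Pi\<^sub>M Basis (\<lambda>_. lborel)) * (\<integral>\<^sup>+f. v (T f) \<partial>Pi\<^sub>M Basis (\<lambda>_. lborel))
      \<le> (\<integral>\<^sup>+f. h (T f) \<partial>Pi\<^sub>M Basis (\<lambda>_. lborel))\<^sup>2"
  proof (rule prekopa_leindler_PiM)
    fix x y :: "'a \<Rightarrow> real"
    have "T (\<lambda>i\<in>Basis. (x i + y i) / 2) = (1/2) *\<^sub>R (T x + T y)"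
      by (simp add: T_def scaleR_sum_right sum.distrib[symmetric] algebra_simps add_divide_distrib
          cong: sum.cong)
    then show "u (T x) * v (T y) \<le> (h (T (\<lambda>i\<in>Basis. (x i + y i) / 2)))\<^sup>2"
      using mid by simp
  qed (simp, measurable)
  then show ?thesis by (simp add: push)
qed

section \<open>Second-order expansion of exponential integrals\<close>

text \<open>Taylor's formula to third order, whose remainder \<open>exp z * t ^ 4 / 24\<close> is nonnegative for both
  signs of \<open>t\<close>. The cubic error has a constant independent of \<open>a\<close> and \<open>b\<close>, so
  the bound can be integrated.\<close>

lemma exp_perturbation_lower_bound:
  fixes a b e B :: real
  assumes e: "0 \<le> e" "e \<le> 1" and a: "\<bar>a\<bar> \<le> B" and b: "\<bar>b\<bar> \<le> B"
  shows "1 + e * a + e\<^sup>2 * (a\<^sup>2 / 2 - b) - e ^ 3 * (B\<^sup>2 + 2 * B ^ 3) \<le> exp (e * a - e\<^sup>2 * b)"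
proof -
  define t where "t = e * a - e\<^sup>2 * b"
  obtain z where "exp t = (\<Sum>m<4. t ^ m / fact m) + exp z / fact 4 * t ^ 4"
    using Maclaurin_exp_le[of t 4] by blast
  moreover have "0 \<le> exp z / fact 4 * t ^ 4" by simp
  ultimately have "exp t \<ge> (\<Sum>m<4. t ^ m / fact m)" by linarith
  also have "(\<Sum>m<4. t ^ m / fact m) = 1 + t + t\<^sup>2 / 2 + t ^ 3 / 6"
    by (simp add: eval_nat_numeral)
  finally have taylor: "1 + t + t\<^sup>2 / 2 + t ^ 3 / 6 \<le> exp t" .
  have B: "0 \<le> B" using a by simp
  have "\<bar>t\<bar> \<le> e * \<bar>a\<bar> + e\<^sup>2 * \<bar>b\<bar>"
    unfolding t_def using abs_triangle_ineq4[of "e * a" "e\<^sup>2 * b"] e by (simp add: abs_mult)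
  also have "\<dots> \<le> e * B + e * B"
    using a b B e by (intro add_mono mult_mono) (auto simp: power2_eq_square intro: mult_left_le_one_le)
  finally have "\<bar>t\<bar> \<le> 2 * (e * B)" by (simp add: mult.commute)
  then have "\<bar>t\<bar> ^ 3 \<le> (2 * (e * B)) ^ 3" by (intro power_mono) auto
  then have "\<bar>t ^ 3\<bar> \<le> 8 * (e ^ 3 * B ^ 3)"
    by (simp add: power_mult_distrib power_abs)
  then have cube: "- (2 * (e ^ 3 * B ^ 3)) \<le> t ^ 3 / 6"
    using B e by (simp add: abs_le_iff)
  have "\<bar>a * b\<bar> \<le> B\<^sup>2"
    using a b B by (simp add: abs_mult power2_eq_square mult_mono)
  then have "a * b \<le> B\<^sup>2" by simp
  then have "e ^ 3 * (a * b) \<le> e ^ 3 * B\<^sup>2"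
    using e by (intro mult_left_mono) auto
  moreover have "t\<^sup>2 / 2 = e\<^sup>2 * a\<^sup>2 / 2 - e ^ 3 * (a * b) + (e\<^sup>2 * b)\<^sup>2 / 2"
    by (simp add: t_def power2_eq_square power3_eq_cube field_simps)
  ultimately have "e\<^sup>2 * a\<^sup>2 / 2 - e ^ 3 * B\<^sup>2 \<le> t\<^sup>2 / 2"
    by (smt (verit) zero_le_power2 divide_nonneg_nonneg)
  then have "1 + t + (e\<^sup>2 * a\<^sup>2 / 2 - e ^ 3 * B\<^sup>2) - 2 * (e ^ 3 * B ^ 3) \<le> exp t"
    using taylor cube by linarith
  then show ?thesis
    by (simp add: t_def algebra_simps)
qed

text \<open>Both integrals are bounded below by cubic polynomials in \<open>e\<close> with value \<open>Z\<close>, the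
  total mass, at \<open>0\<close>. In their product the terms of order \<open>e\<close> cancel, and the
  coefficient of \<open>e\<^sup>2\<close> is the difference of the two sides of the conclusion; it cannot be
  positive if the product stays below \<open>Z\<^sup>2\<close> for small \<open>e\<close>.\<close>

lemma (in finite_measure) variance_le_of_exponential_bound:
  fixes f g :: "'a \<Rightarrow> real"
  assumes [measurable]: "f \<in> borel_measurable M" "g \<in> borel_measurable M"
    and bdd: "\<And>x. \<bar>f x\<bar> \<le> B" "\<And>x. \<bar>g x\<bar> \<le> B"
    and exp_bound: "\<forall>\<^sub>F e in at_right 0.
      (LINT x|M. exp (e * f x - e\<^sup>2 * g x)) * (LINT x|M. exp (- e * f x)) \<le> (measure M (space M))\<^sup>2"
  shows "measure M (space M) * (LINT x|M. (f x)\<^sup>2) - (LINT x|M. f x)\<^sup>2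
    \<le> measure M (space M) * (LINT x|M. g x)"
proof -
  define Z where "Z = measure M (space M)"
  define F1 F2 G where "F1 = (LINT x|M. f x)" and "F2 = (LINT x|M. (f x)\<^sup>2)" and "G = (LINT x|M. g x)"
  define C where "C = (B\<^sup>2 + 2 * B ^ 3) * Z"
  have B: "0 \<le> B" using bdd(1) by (meson abs_ge_zero order_trans)
  have int: "integrable M f" "integrable M g"
    using bdd by (auto intro!: integrable_const_bound[where B = B])
  have "\<bar>(f x)\<^sup>2\<bar> \<le> B\<^sup>2" for x
    using power_mono[OF bdd(1), of x 2] by simp
  then have int2: "integrable M (\<lambda>x. (f x)\<^sup>2)"
    by (auto intro!: integrable_const_bound[where B = "B\<^sup>2"])
  have int_exp: "integrable M (\<lambda>x. exp (e * f x - e\<^sup>2 * h x))"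
    if [measurable]: "h \<in> borel_measurable M" and "\<And>x. \<bar>h x\<bar> \<le> B" and "0 \<le> e" for e h
  proof (rule integrable_const_bound[where B = "exp (e * B + e\<^sup>2 * B)"])
    have "e * f x - e\<^sup>2 * h x \<le> e * B + e\<^sup>2 * B" for x
    proof -
      have "e * f x \<le> e * B"
        using bdd(1)[of x] that(3) by (intro mult_left_mono) auto
      moreover have "e\<^sup>2 * (- h x) \<le> e\<^sup>2 * B"
        using that(2)[of x] by (intro mult_left_mono) auto
      ultimately show ?thesis by simp
    qed
    then show "AE x in M. norm (exp (e * f x - e\<^sup>2 * h x)) \<le> exp (e * B + e\<^sup>2 * B)"
      by simp
  qed measurable
  have lower: "Z + e * F1 + e\<^sup>2 * (F2 / 2 - G) - e ^ 3 * C \<le> (LINT x|M. exp (e * f x - e\<^sup>2 * g x))"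
    if e: "0 \<le> e" "e \<le> 1" for e
  proof -
    have "(LINT x|M. 1 + e * f x + e\<^sup>2 * ((f x)\<^sup>2 / 2 - g x) - e ^ 3 * (B\<^sup>2 + 2 * B ^ 3))
        \<le> (LINT x|M. exp (e * f x - e\<^sup>2 * g x))"
      using int int2 int_exp bdd e
      by (intro integral_mono exp_perturbation_lower_bound) auto
    also have "(LINT x|M. 1 + e * f x + e\<^sup>2 * ((f x)\<^sup>2 / 2 - g x) - e ^ 3 * (B\<^sup>2 + 2 * B ^ 3))
        = Z + e * F1 + e\<^sup>2 * (F2 / 2 - G) - e ^ 3 * C"
      using int int2 by (simp add: Z_def F1_def F2_def G_def C_def)
    finally show ?thesis .
  qed
  have lower': "Z - e * F1 + e\<^sup>2 * (F2 / 2) - e ^ 3 * C \<le> (LINT x|M. exp (- e * f x))"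
    if e: "0 \<le> e" "e \<le> 1" for e
  proof -
    have ie: "integrable M (\<lambda>x. exp (- (e * f x)))"
    proof (rule integrable_const_bound[where B = "exp (e * B)"])
      have "- (e * f x) \<le> e * B" for x
        using mult_left_mono[of "- f x" B e] bdd(1)[of x] e by auto
      then show "AE x in M. norm (exp (- (e * f x))) \<le> exp (e * B)" by simp
    qed measurable
    have "1 - e * f x + e\<^sup>2 * ((f x)\<^sup>2 / 2) - e ^ 3 * (B\<^sup>2 + 2 * B ^ 3) \<le> exp (- (e * f x))" for x
      using exp_perturbation_lower_bound[OF e, of "- f x" B 0] bdd(1)[of x] B by simp
    then have "(LINT x|M. 1 - e * f x + e\<^sup>2 * ((f x)\<^sup>2 / 2) - e ^ 3 * (B\<^sup>2 + 2 * B ^ 3))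
        \<le> (LINT x|M. exp (- (e * f x)))"
      using int int2 ie by (intro integral_mono) auto
    also have "(LINT x|M. 1 - e * f x + e\<^sup>2 * ((f x)\<^sup>2 / 2) - e ^ 3 * (B\<^sup>2 + 2 * B ^ 3))
        = Z - e * F1 + e\<^sup>2 * (F2 / 2) - e ^ 3 * C"
      using int int2 by (simp add: Z_def F1_def F2_def G_def C_def)
    finally show ?thesis by simp
  qed
  define a b where "a e = Z + e * F1 + e\<^sup>2 * (F2 / 2 - G) - e ^ 3 * C"
    and "b e = Z - e * F1 + e\<^sup>2 * (F2 / 2) - e ^ 3 * C" for e :: real
  define P where "P e = Z * (F2 - G) - F1\<^sup>2 + e * (F1 * G - 2 * Z * C)
      + e\<^sup>2 * ((F2 / 2 - G) * (F2 / 2)) + e ^ 3 * (C * G - C * F2) + e ^ 4 * C\<^sup>2" for e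
  have ab: "a e * b e = Z\<^sup>2 + e\<^sup>2 * P e" for e
    unfolding a_def b_def P_def by (simp add: power2_eq_square eval_nat_numeral field_simps)
  show ?thesis
  proof (cases "Z = 0")
    case True
    then have "AE x in M. False"
      by (intro AE_I[of _ _ "space M"]) (auto simp: Z_def emeasure_eq_measure)
    then have "F1 = 0"
      unfolding F1_def by (intro integral_eq_zero_AE) auto
    then show ?thesis using True by (simp add: Z_def F1_def)
  next
    case False
    then have Z: "0 < Z" by (simp add: Z_def less_le)
    have lim: "(a \<longlongrightarrow> a 0) (at_right 0)" "(b \<longlongrightarrow> b 0) (at_right 0)"
        "(P \<longlongrightarrow> P 0) (at_right 0)"
      unfolding a_def b_def P_def by (auto intro!: tendsto_eq_intros)
    have "\<forall>\<^sub>F e in at_right 0. 0 < a e" "\<forall>\<^sub>F e in at_right 0. 0 < b e"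
      using order_tendstoD(1)[OF lim(1), of 0] order_tendstoD(1)[OF lim(2), of 0] Z
      by (simp_all add: a_def b_def)
    moreover have "\<forall>\<^sub>F e in at_right 0. 0 < (e::real)" "\<forall>\<^sub>F e in at_right 0. e < (1::real)"
      by (auto simp: eventually_at_right_field intro: exI[of _ 1])
    ultimately have "\<forall>\<^sub>F e in at_right 0. P e \<le> 0"
      using exp_bound
    proof eventually_elim
      case (elim e)
      have "a e * b e \<le> (LINT x|M. exp (e * f x - e\<^sup>2 * g x)) * (LINT x|M. exp (- e * f x))"
        using elim lower[of e] lower'[of e]
        by (intro mult_mono) (auto simp: a_def b_def)
      then have "e\<^sup>2 * P e \<le> 0" using elim by (simp add: ab Z_def)
      then show ?case using elim by (simp add: mult_le_0_iff)
    qed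
    then have "P 0 \<le> 0"
      by (rule tendsto_upperbound[OF lim(3)]) simp
    then show ?thesis by (simp add: P_def Z_def F1_def F2_def G_def algebra_simps)
  qed
qed

section \<open>Uniformly log-concave weights\<close>

text \<open>The mean value inequality for \<open>z \<mapsto> f z - D x \<bullet> z\<close>, whose gradient at \<open>z\<close> is
  at most \<open>M * norm (z - x)\<close>. The gradient is taken at \<open>x\<close> only, because the functions
  in Maurey's argument treat the two endpoints asymmetrically.\<close>

lemma has_derivative_lipschitz_gradient_bound:
  fixes f :: "'a::euclidean_space \<Rightarrow> real"
  assumes L: "convex L" "x \<in> L" "y \<in> L"
    and grad: "\<And>x. x \<in> L \<Longrightarrow> (f has_derivative (\<lambda>h. D x \<bullet> h)) (at x within L)"
    and lip: "M-lipschitz_on L D"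
  shows "f x - f y \<le> norm (D x) * norm (x - y) + M * (norm (x - y))\<^sup>2"
proof -
  have sub: "closed_segment x y \<subseteq> L" using L by (simp add: closed_segment_subset)
  have M: "0 \<le> M" using lip by (rule lipschitz_on_nonneg)
  have "norm ((f x - D x \<bullet> x) - (f y - D x \<bullet> y)) \<le> (M * norm (x - y)) * norm (x - y)"
  proof (rule differentiable_bound[of "closed_segment x y" "\<lambda>z. f z - D x \<bullet> z" "\<lambda>z h. (D z - D x) \<bullet> h"])
    fix z assume z: "z \<in> closed_segment x y"
    then have "(f has_derivative (\<lambda>h. D z \<bullet> h)) (at z within closed_segment x y)"
      using grad sub by (meson has_derivative_subset subsetD)
    then show "((\<lambda>z. f z - D x \<bullet> z) has_derivative (\<lambda>h. (D z - D x) \<bullet> h)) (at z within closed_segment x y)"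
      by (auto intro!: derivative_eq_intros simp: inner_diff_left)
    have "norm (D z - D x) \<le> M * norm (z - x)"
      using lipschitz_onD[OF lip, of z x] z sub L by (auto simp: dist_norm)
    also have "\<dots> \<le> M * norm (x - y)"
      using segment_bound1[OF z] M by (intro mult_left_mono) (auto simp: norm_minus_commute)
    finally show "onorm (\<lambda>h. (D z - D x) \<bullet> h) \<le> M * norm (x - y)"
      by (intro onorm_bound) (auto simp: M intro!: order_trans[OF Cauchy_Schwarz_ineq2] mult_right_mono)
  qed auto
  then have "f x - f y - D x \<bullet> (x - y) \<le> M * (norm (x - y))\<^sup>2"
    by (simp add: power2_eq_square inner_diff_right mult.assoc)
  then show ?thesis using norm_cauchy_schwarz[of "D x" "x - y"] by linarith
qed

lemma bounded_indicator_mult: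
  fixes g :: "'a \<Rightarrow> real"
  assumes "\<And>x. x \<in> L \<Longrightarrow> \<bar>g x\<bar> \<le> B" "0 \<le> B"
  shows "\<bar>indicator L x * g x\<bar> \<le> B"
  using assms by (auto simp: indicator_def)

lemma compact_continuous_bound:
  fixes g :: "'a::topological_space \<Rightarrow> real"
  assumes "compact L" "continuous_on L g"
  obtains B where "0 \<le> B" "\<And>x. x \<in> L \<Longrightarrow> \<bar>g x\<bar> \<le> B"
proof -
  have "bounded (g ` L)" using assms by (intro compact_imp_bounded compact_continuous_image)
  then obtain B where "0 < B" "\<forall>y\<in>g ` L. norm y \<le> B" using bounded_pos by metis
  then show thesis using that[of B] by auto
qed

lemma borel_measurable_indicator_continuous:
  fixes g :: "'a::euclidean_space \<Rightarrow> real"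
  assumes "compact L" "continuous_on L g"
  shows "(\<lambda>x. indicator L x * g x) \<in> borel_measurable borel"
  using borel_measurable_continuous_on_indicator[of L g] assms by (simp add: borel_compact)

lemma finite_measure_exp_weight:
  fixes V :: "'a::euclidean_space \<Rightarrow> real"
  assumes L: "compact L" and V: "continuous_on L V"
  shows "finite_measure (density lborel (\<lambda>x. ennreal (indicator L x * exp (- V x))))"
proof
  have "continuous_on L (\<lambda>x. exp (- V x))" using V by (intro continuous_intros)
  then have [measurable]: "(\<lambda>x. indicator L x * exp (- V x)) \<in> borel_measurable borel"
    using L by (rule borel_measurable_indicator_continuous[rotated])
  obtain B where B: "0 \<le> B" "\<And>x. x \<in> L \<Longrightarrow> \<bar>exp (- V x)\<bar> \<le> B"
    using compact_continuous_bound[OF L \<open>continuous_on L (\<lambda>x. exp (- V x))\<close>] by blast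
  have [measurable]: "L \<in> sets borel" using L by (rule borel_compact)
  have "emeasure (density lborel (\<lambda>x. ennreal (indicator L x * exp (- V x)))) UNIV
      = (\<integral>\<^sup>+x. ennreal (indicator L x * exp (- V x)) \<partial>lborel)"
    by (subst emeasure_density) auto
  also have "\<dots> \<le> (\<integral>\<^sup>+x. ennreal B * indicator L x \<partial>lborel)"
    using B by (intro nn_integral_mono) (auto simp: indicator_def intro!: ennreal_leI)
  also have "\<dots> = ennreal B * emeasure lborel L"
    by (simp add: nn_integral_cmult)
  also have "\<dots> < top"
    using emeasure_bounded_finite[OF compact_imp_bounded[OF L]] by (simp add: ennreal_mult_less_top)
  finally show "emeasure (density lborel (\<lambda>x. ennreal (indicator L x * exp (- V x))))
      (space (density lborel (\<lambda>x. ennreal (indicator L x * exp (- V x))))) \<noteq> \<infinity>"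
    by (simp add: less_top[symmetric])
qed

text \<open>Prekopa-Leindler for the functions \<open>w * exp p\<close>, \<open>w * exp q\<close> and \<open>w\<close>, read as a
  statement about the measure with density \<open>w\<close>.\<close>

lemma exponential_bound_of_prekopa_leindler:
  fixes w p q :: "'a::euclidean_space \<Rightarrow> real"
  assumes [measurable]: "w \<in> borel_measurable borel" "p \<in> borel_measurable borel"
      "q \<in> borel_measurable borel"
    and w: "\<And>x. 0 \<le> w x"
    and mid: "\<And>x y. w x * exp (p x) * (w y * exp (q y)) \<le> (w ((1/2) *\<^sub>R (x + y)))\<^sup>2"
    and fin: "finite_measure (density lborel (\<lambda>x. ennreal (w x)))" (is "finite_measure ?N")
    and bdd: "\<And>x. p x \<le> B" "\<And>x. q x \<le> B"
  shows "(LINT x|?N. exp (p x)) * (LINT x|?N. exp (q x)) \<le> (measure ?N (space ?N))\<^sup>2"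
proof -
  interpret N: finite_measure ?N by fact
  have int: "(\<integral>\<^sup>+x. ennreal (w x * exp (r x)) \<partial>lborel) = ennreal (LINT x|?N. exp (r x))"
    if [measurable]: "r \<in> borel_measurable borel" and "\<And>x. r x \<le> B" for r
  proof -
    have "integrable ?N (\<lambda>x. exp (r x))"
      using that by (intro N.integrable_const_bound[where B = "exp B"]) auto
    then have "ennreal (LINT x|?N. exp (r x)) = (\<integral>\<^sup>+x. ennreal (exp (r x)) \<partial>?N)"
      by (subst nn_integral_eq_integral) auto
    also have "\<dots> = (\<integral>\<^sup>+x. ennreal (w x * exp (r x)) \<partial>lborel)"
      using w by (subst nn_integral_density) (auto simp: ennreal_mult)
    finally show ?thesis ..
  qed
  have mass: "(\<integral>\<^sup>+x. ennreal (w x) \<partial>lborel) = ennreal (measure ?N (space ?N))"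
    by (simp add: N.emeasure_eq_measure[symmetric] emeasure_density)
  have "(\<integral>\<^sup>+x. ennreal (w x * exp (p x)) \<partial>lborel) * (\<integral>\<^sup>+x. ennreal (w x * exp (q x)) \<partial>lborel)
      \<le> (\<integral>\<^sup>+x. ennreal (w x) \<partial>lborel)\<^sup>2"
    using mid w
    by (intro prekopa_leindler_midpoint) (auto simp: ennreal_power simp flip: ennreal_mult intro!: ennreal_leI)
  then have "ennreal ((LINT x|?N. exp (p x)) * (LINT x|?N. exp (q x)))
      \<le> ennreal ((measure ?N (space ?N))\<^sup>2)"
    by (simp add: int bdd mass ennreal_mult ennreal_power)
  then show ?thesis by (simp add: ennreal_le_iff)
qed

text \<open>Maurey's argument with \<open>p = e * f - e\<^sup>2 * norm (D x)\<^sup>2 / t\<close> and \<open>q = - e * f\<close>, for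
  any \<open>t < s\<close>. The gap \<open>s - t\<close> pays for the second-order error of \<open>f\<close>, which is of
  size \<open>e * M * norm (x - y)\<^sup>2\<close> and thus dominated for small \<open>e\<close>; letting \<open>t\<close> tend
  to \<open>s\<close> gives the stated constant.\<close>

theorem poincare_strongly_log_concave:
  fixes L :: "'a::euclidean_space set" and V f :: "'a \<Rightarrow> real" and D :: "'a \<Rightarrow> 'a"
  assumes L: "compact L" "convex L" and V: "continuous_on L V" and s: "0 < s"
    and strong: "\<And>x y. x \<in> L \<Longrightarrow> y \<in> L \<Longrightarrow>
      2 * V ((1/2) *\<^sub>R (x + y)) + s / 4 * (norm (x - y))\<^sup>2 \<le> V x + V y"
    and grad: "\<And>x. x \<in> L \<Longrightarrow> (f has_derivative (\<lambda>h. D x \<bullet> h)) (at x within L)"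
    and lip: "M-lipschitz_on L D"
  defines "N \<equiv> density lborel (\<lambda>x. ennreal (indicator L x * exp (- V x)))"
  shows "s * (measure N (space N) * (LINT x|N. indicator L x * (f x)\<^sup>2) - (LINT x|N. indicator L x * f x)\<^sup>2)
    \<le> measure N (space N) * (LINT x|N. indicator L x * (norm (D x))\<^sup>2)"
proof -
  interpret N: finite_measure N
    unfolding N_def using L(1) V by (rule finite_measure_exp_weight)
  have sets_N[simp, measurable_cong]: "sets N = sets borel" and space_N[simp]: "space N = UNIV"
    by (simp_all add: N_def)
  define w where "w x = indicator L x * exp (- V x)" for x
  define F where "F x = indicator L x * f x" for x
  define g where "g x = indicator L x * (norm (D x))\<^sup>2" for x
  have cont_f: "continuous_on L f"
    using grad by (rule has_derivative_continuous_on)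
  have cont_g: "continuous_on L (\<lambda>x. (norm (D x))\<^sup>2)"
    by (intro continuous_intros lipschitz_on_continuous_on[OF lip])
  have meas[measurable]: "w \<in> borel_measurable borel" "F \<in> borel_measurable borel"
      "g \<in> borel_measurable borel"
    unfolding w_def[abs_def] F_def[abs_def] g_def[abs_def] using L V cont_f cont_g
    by (auto intro!: borel_measurable_indicator_continuous continuous_intros)
  obtain Bf where Bf: "0 \<le> Bf" "\<And>x. x \<in> L \<Longrightarrow> \<bar>f x\<bar> \<le> Bf"
    using compact_continuous_bound[OF L(1) cont_f] by blast
  obtain Bg where Bg: "0 \<le> Bg" "\<And>x. x \<in> L \<Longrightarrow> \<bar>(norm (D x))\<^sup>2\<bar> \<le> Bg"
    using compact_continuous_bound[OF L(1) cont_g] by blast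
  have F: "\<bar>F x\<bar> \<le> Bf" and g: "\<bar>g x\<bar> \<le> Bg" for x
    unfolding F_def g_def
    using bounded_indicator_mult[OF Bf(2,1)] bounded_indicator_mult[OF Bg(2,1)] by auto
  define X where "X = measure N (space N) * (LINT x|N. (F x)\<^sup>2) - (LINT x|N. F x)\<^sup>2"
  have main: "t * X \<le> measure N (space N) * (LINT x|N. g x)" if t: "0 < t" "t < s" for t
  proof -
    have ev: "\<forall>\<^sub>F e in at_right 0. 0 < e \<and> e * M \<le> (s - t) / 4"
    proof -
      have lim: "((\<lambda>e. e * M) \<longlongrightarrow> 0) (at_right (0::real))"
        by (auto intro!: tendsto_eq_intros)
      have "\<forall>\<^sub>F e in at_right 0. e * M < (s - t) / 4"
        using order_tendstoD(2)[OF lim, of "(s - t) / 4"] t by simp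
      then show ?thesis
        using eventually_at_right_less[of "0::real"] by eventually_elim auto
    qed
    have "\<forall>\<^sub>F e in at_right 0. (LINT x|N. exp (e * F x - e\<^sup>2 * (g x / t))) * (LINT x|N. exp (- e * F x))
        \<le> (measure N (space N))\<^sup>2"
      using ev
    proof eventually_elim
      case (elim e)
      then have e: "0 < e" "e * M \<le> (s - t) / 4" by auto
      have key: "e * F x - e\<^sup>2 * (g x / t) - e * F y \<le> s / 4 * (norm (x - y))\<^sup>2"
        if xy: "x \<in> L" "y \<in> L" for x y
      proof -
        define d where "d = norm (x - y)"
        define c where "c = norm (D x)"
        have "e * (f x - f y) \<le> e * (c * d + M * d\<^sup>2)"
          using has_derivative_lipschitz_gradient_bound[OF L(2) xy grad lip] e
          by (intro mult_left_mono) (auto simp: c_def d_def)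
        also have "\<dots> = e * c * d + (e * M) * d\<^sup>2" by (simp add: algebra_simps)
        \<comment> \<open>Completing the square splits the convexity budget \<open>s / 4\<close> into \<open>t / 4\<close> for
          the gradient term and \<open>(s - t) / 4\<close> for the second-order error.\<close>
        also have "e * c * d \<le> e\<^sup>2 * (c\<^sup>2 / t) + t / 4 * d\<^sup>2"
        proof -
          have "0 \<le> (e * c - t / 2 * d)\<^sup>2 / t" using t by simp
          also have "\<dots> = e\<^sup>2 * (c\<^sup>2 / t) + t / 4 * d\<^sup>2 - e * c * d"
            using t by (simp add: power2_eq_square field_simps)
          finally show ?thesis by simp
        qed
        also have "(e * M) * d\<^sup>2 \<le> (s - t) / 4 * d\<^sup>2"
          using e by (intro mult_right_mono) auto
        finally have "e * (f x - f y) \<le> e\<^sup>2 * (c\<^sup>2 / t) + s / 4 * d\<^sup>2"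
          by (simp add: algebra_simps diff_divide_distrib)
        then show ?thesis using xy by (simp add: F_def g_def c_def d_def algebra_simps)
      qed
      show ?case
        unfolding N_def w_def[symmetric]
      proof (rule exponential_bound_of_prekopa_leindler[where B = "e * Bf"])
        show "finite_measure (density lborel (\<lambda>x. ennreal (w x)))"
          using N.finite_measure_axioms by (simp add: N_def w_def)
        fix x y
        have "0 \<le> g x" by (simp add: g_def)
        then have "0 \<le> e\<^sup>2 * (g x / t)" using t by simp
        then show "e * F x - e\<^sup>2 * (g x / t) \<le> e * Bf"
          using mult_left_mono[of "F x" Bf e] F[of x] e by (smt (verit))
        show "- e * F x \<le> e * Bf"
          using mult_left_mono[of "- F x" Bf e] F[of x] e by auto
        show "0 \<le> w x" by (simp add: w_def)
        show "w x * exp (e * F x - e\<^sup>2 * (g x / t)) * (w y * exp (- e * F y))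
            \<le> (w ((1/2) *\<^sub>R (x + y)))\<^sup>2"
        proof (cases "x \<in> L \<and> y \<in> L")
          case True
          then have "(1/2) *\<^sub>R x + (1/2) *\<^sub>R y \<in> L" using L(2) by (intro convexD) auto
          then have m: "(1/2) *\<^sub>R (x + y) \<in> L" by (simp add: scaleR_add_right)
          have "w x * exp (e * F x - e\<^sup>2 * (g x / t)) * (w y * exp (- e * F y))
              = exp (- V x + (e * F x - e\<^sup>2 * (g x / t)) + (- V y + - e * F y))"
            using True by (simp only: w_def exp_add) simp
          also have "\<dots> \<le> exp (- V ((1/2) *\<^sub>R (x + y)) + - V ((1/2) *\<^sub>R (x + y)))"
            unfolding exp_le_cancel_iff using key[of x y] strong[of x y] True by linarith
          also have "\<dots> = (w ((1/2) *\<^sub>R (x + y)))\<^sup>2"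
            using m by (simp only: w_def exp_add power2_eq_square) simp
          finally show ?thesis .
        qed (auto simp: w_def)
      qed measurable
    qed
    then have "measure N (space N) * (LINT x|N. (F x)\<^sup>2) - (LINT x|N. F x)\<^sup>2
        \<le> measure N (space N) * (LINT x|N. g x / t)"
      using F g t
      by (intro N.variance_le_of_exponential_bound[where B = "max Bf (Bg / t)"])
        (auto simp: le_max_iff_disj abs_divide divide_right_mono)
    then show ?thesis using t by (simp add: X_def field_simps)
  qed
  have "s * X \<le> measure N (space N) * (LINT x|N. g x)"
  proof (rule field_le_mult_one_interval)
    fix z :: real assume "0 < z" "z < 1"
    then show "z * (s * X) \<le> measure N (space N) * (LINT x|N. g x)"
      using main[of "z * s"] s by (simp add: mult.assoc)
  qed
  moreover have "(F x)\<^sup>2 = indicator L x * (f x)\<^sup>2" for x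
    by (simp add: F_def indicator_def)
  ultimately show ?thesis by (simp add: X_def F_def g_def)
qed

section \<open>Log-concave weights on compact convex sets\<close>

text \<open>The parallelogram law shows that the quadratic term is uniformly convex with modulus
  \<open>s\<close>.\<close>

lemma convex_plus_quadratic_midpoint:
  fixes \<rho> :: "'a::real_inner \<Rightarrow> real"
  assumes "convex_on L \<rho>" "x \<in> L" "y \<in> L"
  shows "2 * (\<rho> ((1/2) *\<^sub>R (x + y)) + s / 2 * (norm ((1/2) *\<^sub>R (x + y)))\<^sup>2) + s / 4 * (norm (x - y))\<^sup>2
    \<le> (\<rho> x + s / 2 * (norm x)\<^sup>2) + (\<rho> y + s / 2 * (norm y)\<^sup>2)"
proof -
  have "\<rho> ((1/2) *\<^sub>R (x + y)) \<le> (1/2) * \<rho> x + (1/2) * \<rho> y"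
    using convex_onD[OF assms(1), of "1/2" x y] assms(2,3) by (simp add: scaleR_add_right)
  moreover have "s / 4 * ((norm (x + y))\<^sup>2 + (norm (x - y))\<^sup>2)
      = s / 4 * (2 * (norm x)\<^sup>2 + 2 * (norm y)\<^sup>2)"
    by (simp add: power2_norm_eq_inner inner_add_left inner_add_right inner_diff_left
        inner_diff_right inner_commute)
  then have "s / 4 * (norm (x + y))\<^sup>2 + s / 4 * (norm (x - y))\<^sup>2
      = s / 2 * (norm x)\<^sup>2 + s / 2 * (norm y)\<^sup>2"
    by (simp only: distrib_left)
  moreover have "2 * (s / 2 * (norm ((1/2) *\<^sub>R (x + y)))\<^sup>2) = s / 4 * (norm (x + y))\<^sup>2"
    by (simp add: power2_eq_square)
  ultimately show ?thesis unfolding distrib_left by linarith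
qed

text \<open>The weight \<open>k\<close> is the Gaussian factor \<open>exp (- norm x\<^sup>2 / (2 R\<^sup>2))\<close>. The variance
  under \<open>N\<close> is at most the mean square distance of \<open>f\<close> from any constant; the constant
  chosen is the mean \<open>c\<close> of \<open>f\<close> for the weighted measure. Comparing the integrals of
  \<open>(f - c)\<^sup>2\<close> instead of the variances confines the loss to the single
  factor in \<open>1 \<le> 2 * k\<close>; on the gradient side \<open>k \<le> 1\<close> costs nothing.\<close>

theorem poincare_log_concave_compact:
  fixes L :: "'a::euclidean_space set" and \<rho> f :: "'a \<Rightarrow> real" and D :: "'a \<Rightarrow> 'a"
  assumes L: "compact L" "convex L" and R: "0 < R" "\<And>x. x \<in> L \<Longrightarrow> norm x \<le> R"
    and \<rho>: "continuous_on L \<rho>" "convex_on L \<rho>"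
    and grad: "\<And>x. x \<in> L \<Longrightarrow> (f has_derivative (\<lambda>h. D x \<bullet> h)) (at x within L)"
    and lip: "M-lipschitz_on L D"
  defines "N \<equiv> density lborel (\<lambda>x. ennreal (indicator L x * exp (- \<rho> x)))"
  shows "measure N L * (LINT x|N. indicator L x * (f x)\<^sup>2) - (LINT x|N. indicator L x * f x)\<^sup>2
    \<le> measure N L * (2 * R\<^sup>2 * (LINT x|N. indicator L x * (norm (D x))\<^sup>2))"
proof -
  interpret N: finite_measure N
    unfolding N_def using L(1) \<rho>(1) by (rule finite_measure_exp_weight)
  have sets_N[simp, measurable_cong]: "sets N = sets borel" and space_N[simp]: "space N = UNIV"
    by (simp_all add: N_def)
  have [measurable]: "L \<in> sets borel" using L(1) by (rule borel_compact)
  have cont_f: "continuous_on L f"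
    using grad by (rule has_derivative_continuous_on)
  have cont_D: "continuous_on L D"
    using lip by (rule lipschitz_on_continuous_on)
  \<comment> \<open>All integrals below are of this form, with \<open>\<psi>\<close> continuous on \<open>L\<close>; those for the
    weighted measure \<open>N'\<close> acquire the factor \<open>k\<close>.\<close>
  define I where "I \<psi> = (LINT x|N. indicator L x * \<psi> x)" for \<psi> :: "'a \<Rightarrow> real"
  have I_int: "integrable N (\<lambda>x. indicator L x * \<psi> x)" if \<psi>: "continuous_on L \<psi>" for \<psi> :: "'a \<Rightarrow> real"
  proof -
    obtain B where B: "0 \<le> B" "\<And>x. x \<in> L \<Longrightarrow> \<bar>\<psi> x\<bar> \<le> B"
      using compact_continuous_bound[OF L(1) \<psi>] by blast
    show ?thesis
      using borel_measurable_indicator_continuous[OF L(1) \<psi>] bounded_indicator_mult[of L \<psi> B, OF B(2,1)]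
      by (intro N.integrable_const_bound[where B = B]) auto
  qed
  have I_mono: "I \<phi> \<le> I \<psi>"
    if "continuous_on L \<phi>" "continuous_on L \<psi>" "\<And>x. x \<in> L \<Longrightarrow> \<phi> x \<le> \<psi> x" for \<phi> \<psi>
    unfolding I_def using that by (intro integral_mono I_int) (auto simp: indicator_def)
  have I_add: "I (\<lambda>x. \<phi> x + \<psi> x) = I \<phi> + I \<psi>"
    if "continuous_on L \<phi>" "continuous_on L \<psi>" for \<phi> \<psi>
    unfolding I_def distrib_left using that by (intro Bochner_Integration.integral_add I_int)
  have I_scale: "I (\<lambda>x. c * \<psi> x) = c * I \<psi>" for c \<psi>
    unfolding I_def by (simp add: mult.left_commute)
  define V where "V x = \<rho> x + 1 / R\<^sup>2 / 2 * (norm x)\<^sup>2" for x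
  define k where "k x = exp (- (1 / R\<^sup>2 / 2 * (norm x)\<^sup>2))" for x :: 'a
  have cont_V: "continuous_on L V" unfolding V_def by (intro continuous_intros \<rho>)
  have cont_k: "continuous_on L k" unfolding k_def by (intro continuous_intros)
  note cont = cont_f cont_D cont_k
  have k_pos: "0 < k x" and k_le: "k x \<le> 1" for x by (auto simp: k_def)
  have k_ge: "1 \<le> 2 * k x" if "x \<in> L" for x
  proof -
    have "(norm x)\<^sup>2 \<le> R\<^sup>2" using R that by (intro power_mono) auto
    then have "exp (1 / R\<^sup>2 / 2 * (norm x)\<^sup>2) \<le> exp (1 / 2)"
      using R(1) by (simp add: field_simps)
    also have "exp (1 / 2) \<le> (2::real)"
    proof (rule power2_le_imp_le)
      show "(exp (1 / 2))\<^sup>2 \<le> (2::real)\<^sup>2"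
        using exp_le by (simp flip: exp_of_nat_mult)
    qed simp
    finally show ?thesis by (simp add: k_def exp_minus field_simps)
  qed
  define N' where "N' = density lborel (\<lambda>x. ennreal (indicator L x * exp (- V x)))"
  have I': "(LINT x|N'. indicator L x * \<psi> x) = I (\<lambda>x. k x * \<psi> x)"
    if "continuous_on L \<psi>" for \<psi> :: "'a \<Rightarrow> real"
  proof -
    have w: "(\<lambda>x. indicator L x * exp (- \<rho> x)) \<in> borel_measurable borel"
        "(\<lambda>x. indicator L x * exp (- V x)) \<in> borel_measurable borel"
      by (intro borel_measurable_indicator_continuous L continuous_intros cont_V \<rho>)+
    have m: "(\<lambda>x. indicator L x * \<psi> x) \<in> borel_measurable borel"
        "(\<lambda>x. indicator L x * (k x * \<psi> x)) \<in> borel_measurable borel"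
      by (intro borel_measurable_indicator_continuous L continuous_intros cont_k that)+
    have "(LINT x|N'. indicator L x * \<psi> x)
        = (LINT x|lborel. (indicator L x * exp (- V x)) * (indicator L x * \<psi> x))"
      unfolding N'_def using w m by (subst integral_density) auto
    also have "\<dots> = (LINT x|lborel. (indicator L x * exp (- \<rho> x)) * (indicator L x * (k x * \<psi> x)))"
      by (intro Bochner_Integration.integral_cong) (auto simp: V_def k_def exp_add exp_diff exp_minus field_simps)
    also have "\<dots> = I (\<lambda>x. k x * \<psi> x)"
      unfolding N_def I_def using w m by (subst integral_density) auto
    finally show ?thesis .
  qed
  have mass': "measure N' (space N') = I k"
  proof -
    have sN': "space N' = UNIV" "sets N' = sets borel" by (simp_all add: N'_def)
    interpret N': finite_measure N'
      unfolding N'_def using L(1) cont_V by (rule finite_measure_exp_weight)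
    have "emeasure N' (- L) = 0"
      unfolding N'_def using borel_measurable_indicator_continuous[OF L(1), of "\<lambda>x. exp (- V x)"] cont_V
      by (subst emeasure_density) (auto simp: nn_integral_0_iff_AE continuous_intros indicator_def)
    then have "measure N' (- L) = 0" by (simp add: measure_def)
    moreover have "measure N' UNIV = measure N' L + measure N' (- L)"
      using N'.finite_measure_Union[of L "- L"] by (simp add: sN')
    moreover have "measure N' L = I k"
      using I'[of "\<lambda>x. 1"] by (simp add: sN')
    ultimately show ?thesis by (simp add: sN')
  qed
  have mass: "measure N L = I (\<lambda>x. 1)" by (simp add: I_def)
  define Z Z' where "Z = I (\<lambda>x. 1)" and "Z' = I k"
  have "1 / R\<^sup>2 * (measure N' (space N') * (LINT x|N'. indicator L x * (f x)\<^sup>2)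
        - (LINT x|N'. indicator L x * f x)\<^sup>2)
      \<le> measure N' (space N') * (LINT x|N'. indicator L x * (norm (D x))\<^sup>2)"
    unfolding N'_def
  proof (rule poincare_strongly_log_concave[OF L cont_V _ _ grad lip])
    show "2 * V ((1/2) *\<^sub>R (x + y)) + 1 / R\<^sup>2 / 4 * (norm (x - y))\<^sup>2 \<le> V x + V y"
      if "x \<in> L" "y \<in> L" for x y
      unfolding V_def using \<rho>(2) that by (rule convex_plus_quadratic_midpoint)
  qed (use R(1) in auto)
  moreover have "(LINT x|N'. indicator L x * (f x)\<^sup>2) = I (\<lambda>x. k x * (f x)\<^sup>2)"
      "(LINT x|N'. indicator L x * f x) = I (\<lambda>x. k x * f x)"
      "(LINT x|N'. indicator L x * (norm (D x))\<^sup>2) = I (\<lambda>x. k x * (norm (D x))\<^sup>2)"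
    by (intro I' continuous_intros cont)+
  ultimately have "1 / R\<^sup>2 * (Z' * I (\<lambda>x. k x * (f x)\<^sup>2) - (I (\<lambda>x. k x * f x))\<^sup>2)
      \<le> Z' * I (\<lambda>x. k x * (norm (D x))\<^sup>2)"
    by (simp only: mass' Z'_def)
  then have weighted: "Z' * I (\<lambda>x. k x * (f x)\<^sup>2) - (I (\<lambda>x. k x * f x))\<^sup>2
      \<le> R\<^sup>2 * (Z' * I (\<lambda>x. k x * (norm (D x))\<^sup>2))"
    using R(1) by (simp add: field_simps)
  have ZZ': "Z \<le> 2 * Z'"
    unfolding Z_def Z'_def I_scale[symmetric] by (intro I_mono continuous_intros cont k_ge)
  have Z0: "0 \<le> Z" unfolding mass[symmetric] Z_def by simp
  have "Z * I (\<lambda>x. (f x)\<^sup>2) - (I f)\<^sup>2 \<le> Z * (2 * R\<^sup>2 * I (\<lambda>x. (norm (D x))\<^sup>2))"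
  proof (cases "Z = 0")
    case True
    then have "measure N L = 0" by (simp add: mass Z_def)
    then have "AE x in N. x \<notin> L"
      by (intro AE_I[of _ _ L]) (auto simp: N.emeasure_eq_measure)
    then have "I f = 0"
      unfolding I_def by (intro integral_eq_zero_AE) auto
    then show ?thesis using True by simp
  next
    case False
    then have Z': "0 < Z'" using ZZ' Z0 by linarith
    define m c where "m = I (\<lambda>x. k x * f x)" and "c = m / Z'"
    have expand: "I (\<lambda>x. p x * (f x - c)\<^sup>2) = I (\<lambda>x. p x * (f x)\<^sup>2) - 2 * c * I (\<lambda>x. p x * f x) + c\<^sup>2 * I p"
      if p: "continuous_on L p" for p
    proof -
      have "I (\<lambda>x. p x * (f x - c)\<^sup>2)
          = I (\<lambda>x. p x * (f x)\<^sup>2 + ((- 2 * c) * (p x * f x) + c\<^sup>2 * p x))"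
        by (intro arg_cong[where f = I]) (simp add: fun_eq_iff power2_eq_square algebra_simps)
      also have "\<dots> = I (\<lambda>x. p x * (f x)\<^sup>2) + ((- 2 * c) * I (\<lambda>x. p x * f x) + c\<^sup>2 * I p)"
      proof -
        have c: "continuous_on L (\<lambda>x. p x * (f x)\<^sup>2)" "continuous_on L (\<lambda>x. (- 2 * c) * (p x * f x))"
            "continuous_on L (\<lambda>x. c\<^sup>2 * p x)"
          by (intro continuous_intros cont p)+
        show ?thesis
          using I_add[OF c(1) continuous_on_add[OF c(2,3)]] I_add[OF c(2,3)]
          by (simp only: I_scale)
      qed
      finally show ?thesis by simp
    qed
    have "Z' * I (\<lambda>x. k x * (f x - c)\<^sup>2) = Z' * I (\<lambda>x. k x * (f x)\<^sup>2) - m\<^sup>2"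
      unfolding expand[OF cont_k] Z'_def[symmetric] m_def[symmetric] using Z'
      by (simp add: c_def power2_eq_square field_simps)
    then have "Z' * I (\<lambda>x. k x * (f x - c)\<^sup>2) \<le> Z' * (R\<^sup>2 * I (\<lambda>x. k x * (norm (D x))\<^sup>2))"
      using weighted by (simp add: m_def mult.left_commute)
    then have Q': "I (\<lambda>x. k x * (f x - c)\<^sup>2) \<le> R\<^sup>2 * I (\<lambda>x. k x * (norm (D x))\<^sup>2)"
      using Z' by simp
    have "I (\<lambda>x. 1 * (f x - c)\<^sup>2) \<le> I (\<lambda>x. 2 * (k x * (f x - c)\<^sup>2))"
    proof (intro I_mono continuous_intros cont)
      fix x assume "x \<in> L"
      then show "1 * (f x - c)\<^sup>2 \<le> 2 * (k x * (f x - c)\<^sup>2)"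
        unfolding mult.assoc[symmetric] by (intro mult_right_mono k_ge) auto
    qed
    also have "\<dots> \<le> 2 * (R\<^sup>2 * I (\<lambda>x. k x * (norm (D x))\<^sup>2))"
      unfolding I_scale using Q' by simp
    also have "\<dots> \<le> 2 * (R\<^sup>2 * I (\<lambda>x. (norm (D x))\<^sup>2))"
    proof -
      have "k x * (norm (D x))\<^sup>2 \<le> (norm (D x))\<^sup>2" for x
        using mult_right_mono[OF k_le[of x], of "(norm (D x))\<^sup>2"] by simp
      then have "I (\<lambda>x. k x * (norm (D x))\<^sup>2) \<le> I (\<lambda>x. (norm (D x))\<^sup>2)"
        by (intro I_mono continuous_intros cont)
      then show ?thesis by (intro mult_left_mono) auto
    qed
    finally have Q: "I (\<lambda>x. 1 * (f x - c)\<^sup>2) \<le> 2 * R\<^sup>2 * I (\<lambda>x. (norm (D x))\<^sup>2)"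
      by (simp only: mult.assoc)
    have "I (\<lambda>x. 1 * (f x - c)\<^sup>2) = I (\<lambda>x. (f x)\<^sup>2) - 2 * c * I f + c\<^sup>2 * Z"
      using expand[of "\<lambda>x. 1"] by (simp add: Z_def)
    then have "Z * I (\<lambda>x. 1 * (f x - c)\<^sup>2) = Z * I (\<lambda>x. (f x)\<^sup>2) - (I f)\<^sup>2 + (I f - c * Z)\<^sup>2"
      by (simp only:) (simp add: power2_eq_square algebra_simps)
    then have "Z * I (\<lambda>x. (f x)\<^sup>2) - (I f)\<^sup>2 \<le> Z * I (\<lambda>x. 1 * (f x - c)\<^sup>2)"
      by simp
    also have "\<dots> \<le> Z * (2 * R\<^sup>2 * I (\<lambda>x. (norm (D x))\<^sup>2))"
      using Q Z0 by (intro mult_left_mono)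
    finally show ?thesis .
  qed
  then show ?thesis unfolding mass Z_def I_def .
qed

section \<open>Gradients of smooth functions\<close>

text \<open>Differentiability makes the definite description in \<open>gradient\<close> meaningful, and expanding a
  vector in the standard basis identifies its value as the vector of partial derivatives, through
  which smoothness is defined.\<close>

lemma has_derivative_gradient:
  assumes "f differentiable at x"
  shows "(f has_derivative (\<lambda>h. gradient f x \<bullet> h)) (at x)"
    and "gradient f x = (\<chi> i. partial_deriv i f x)"
proof -
  let ?D = "(\<chi> i. partial_deriv i f x)"
  have f: "(f has_derivative frechet_derivative f (at x)) (at x)"
    using assms by (simp add: frechet_derivative_works)
  then have lin: "linear (frechet_derivative f (at x))"
    by (rule has_derivative_linear)
  have "frechet_derivative f (at x) h = ?D \<bullet> h" for h
  proof -
    have "frechet_derivative f (at x) h = frechet_derivative f (at x) (\<Sum>i\<in>UNIV. h $ i *\<^sub>R axis i 1)"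
      by (simp add: basis_expansion scalar_mult_eq_scaleR[symmetric])
    also have "\<dots> = ?D \<bullet> h"
      by (simp add: linear_sum[OF lin] linear_scale[OF lin] inner_vec_def partial_deriv_def mult.commute)
    finally show ?thesis .
  qed
  then have "frechet_derivative f (at x) = (\<lambda>h. ?D \<bullet> h)" by blast
  with f have D: "(f has_derivative (\<lambda>h. ?D \<bullet> h)) (at x)" by simp
  have "GDERIV f x :> ?D" unfolding gderiv_def using D by (simp add: inner_commute)
  moreover have "E = ?D" if "GDERIV f x :> E" for E
  proof -
    have "(\<lambda>h. h \<bullet> E) = (\<lambda>h. ?D \<bullet> h)"
      using that D unfolding gderiv_def by (rule has_derivative_unique)
    then show ?thesis by (metis inner_commute vector_eq_ldot)
  qed
  ultimately show eq: "gradient f x = ?D" unfolding gradient_def by (rule the_equality)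
  show "(f has_derivative (\<lambda>h. gradient f x \<bullet> h)) (at x)" using D by (simp add: eq)
qed

text \<open>A further partial derivative on the right only extends the multi-index at its end.\<close>

lemma smooth_on_partial_deriv:
  assumes "smooth_on K f"
  shows "smooth_on K (partial_deriv i f)"
  unfolding smooth_on_def
proof
  fix "is"
  have "iter_partial_deriv is (partial_deriv i f) = iter_partial_deriv (is @ [i]) f"
    by (simp add: iter_partial_deriv_def)
  then show "iter_partial_deriv is (partial_deriv i f) differentiable_on K"
    using assms by (simp add: smooth_on_def)
qed

lemma smooth_on_imp_differentiable:
  assumes "smooth_on K f"
  shows "f differentiable_on K"
  using assms by (auto simp: smooth_on_def iter_partial_deriv_def dest: spec[of _ "[]"])

lemma smooth_on_has_derivative_gradient:
  assumes "smooth_on K f" "open K" "x \<in> K"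
  shows "(f has_derivative (\<lambda>h. gradient f x \<bullet> h)) (at x within L)"
    and "gradient f x = (\<chi> i. partial_deriv i f x)"
proof -
  have "f differentiable at x"
    using smooth_on_imp_differentiable[OF assms(1)] assms(2,3)
    by (simp add: differentiable_on_eq_differentiable_at)
  from has_derivative_gradient[OF this]
  show "(f has_derivative (\<lambda>h. gradient f x \<bullet> h)) (at x within L)"
    and "gradient f x = (\<chi> i. partial_deriv i f x)"
    by (auto intro: has_derivative_at_withinI)
qed

lemma smooth_on_continuous_gradient:
  assumes "smooth_on K f" "open K"
  shows "continuous_on K (gradient f)"
proof -
  have "continuous_on K (partial_deriv i f)" for i
    using assms by (intro differentiable_imp_continuous_on smooth_on_imp_differentiable smooth_on_partial_deriv)
  then have "continuous_on K (\<lambda>x. \<chi> i. partial_deriv i f x)"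
    by (intro continuous_on_vec_lambda)
  then show ?thesis
    using assms by (simp add: smooth_on_has_derivative_gradient(2) cong: continuous_on_cong)
qed

lemma smooth_on_lipschitz:
  assumes f: "smooth_on K f" "open K" and L: "compact L" "convex L" "L \<subseteq> K"
  shows "\<exists>B. B-lipschitz_on L f"
proof -
  have "continuous_on L (gradient f)"
    using smooth_on_continuous_gradient[OF f] L(3) continuous_on_subset by blast
  then have "bounded (gradient f ` L)"
    using L by (intro compact_imp_bounded compact_continuous_image)
  then obtain B where B: "0 < B" "\<forall>x\<in>L. norm (gradient f x) \<le> B"
    by (auto simp: bounded_pos)
  have "B-lipschitz_on L f"
  proof (rule bounded_derivative_imp_lipschitz)
    fix x assume x: "x \<in> L"
    then show "(f has_derivative (\<lambda>h. gradient f x \<bullet> h)) (at x within L)"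
      using smooth_on_has_derivative_gradient(1)[OF f] L(3) by blast
    show "onorm (\<lambda>h. gradient f x \<bullet> h) \<le> B"
      using B x by (intro onorm_bound) (auto intro!: order_trans[OF Cauchy_Schwarz_ineq2] mult_right_mono)
  qed (use L B in auto)
  then show ?thesis ..
qed

text \<open>Each partial derivative is smooth, hence Lipschitz on \<open>L\<close>; this is the substitute for a bound
  on the Hessian.\<close>

lemma smooth_on_lipschitz_gradient:
  assumes f: "smooth_on K f" "open K" and L: "compact L" "convex L" "L \<subseteq> K"
  shows "\<exists>M. M-lipschitz_on L (gradient f)"
proof -
  have "\<forall>i. \<exists>B. B-lipschitz_on L (partial_deriv i f)"
    using smooth_on_lipschitz[OF smooth_on_partial_deriv[OF f(1)] f(2) L] by blast
  then obtain B where B: "\<And>i. (B i)-lipschitz_on L (partial_deriv i f)" by metis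
  have "(\<Sum>i\<in>UNIV. B i)-lipschitz_on L (gradient f)"
  proof (rule lipschitz_onI)
    fix x y assume xy: "x \<in> L" "y \<in> L"
    have "dist (gradient f x) (gradient f y) \<le> (\<Sum>i\<in>UNIV. \<bar>partial_deriv i f x - partial_deriv i f y\<bar>)"
      using norm_le_l1_cart[of "gradient f x - gradient f y"] xy L(3)
      by (simp add: dist_norm smooth_on_has_derivative_gradient(2)[OF f] subset_iff)
    also have "\<dots> \<le> (\<Sum>i\<in>UNIV. B i * dist x y)"
      using lipschitz_onD[OF B xy] by (intro sum_mono) (simp add: dist_real_def)
    finally show "dist (gradient f x) (gradient f y) \<le> (\<Sum>i\<in>UNIV. B i) * dist x y"
      by (simp add: sum_distrib_right)
  qed (use lipschitz_on_nonneg[OF B] in \<open>auto intro: sum_nonneg\<close>)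
  then show ?thesis ..
qed

section \<open>Exhaustion by erosions\<close>

text \<open>The balls are open so that the erosion is closed: a point fails to belong to it if and only if it
  has distance less than \<open>r\<close> from some point outside \<open>K\<close>.\<close>

definition erosion :: "'a::real_normed_vector set \<Rightarrow> real \<Rightarrow> 'a set"
  where "erosion K r = {x. ball x r \<subseteq> K}"

lemma erosion_subset: "0 < r \<Longrightarrow> erosion K r \<subseteq> K"
  by (auto simp: erosion_def)

lemma closed_erosion: "closed (erosion K r)"
proof -
  have "- erosion K r = (\<Union>y\<in>-K. ball y r)"
    by (auto simp: erosion_def dist_commute)
  then show ?thesis by (simp add: closed_def open_UN)
qed

lemma convex_erosion:
  assumes "convex K"
  shows "convex (erosion K r)"
proof (rule convexI)
  fix x y :: 'a and u v :: real
  assume xy: "x \<in> erosion K r" "y \<in> erosion K r" and uv: "0 \<le> u" "0 \<le> v" "u + v = 1"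
  have "z \<in> K" if z: "z \<in> ball (u *\<^sub>R x + v *\<^sub>R y) r" for z
  proof -
    define h where "h = z - (u *\<^sub>R x + v *\<^sub>R y)"
    have "norm h < r" using z by (simp add: h_def dist_norm norm_minus_commute)
    then have "x + h \<in> K" "y + h \<in> K" using xy by (auto simp: erosion_def dist_norm)
    then have "u *\<^sub>R (x + h) + v *\<^sub>R (y + h) \<in> K" using assms uv by (intro convexD) auto
    moreover have "u *\<^sub>R (x + h) + v *\<^sub>R (y + h) = (u *\<^sub>R x + v *\<^sub>R y) + (u + v) *\<^sub>R h"
      by (simp add: algebra_simps)
    ultimately show ?thesis using uv by (simp add: h_def)
  qed
  then show "u *\<^sub>R x + v *\<^sub>R y \<in> erosion K r" by (auto simp: erosion_def)
qed

lemma incseq_erosion: "incseq (\<lambda>n. erosion K (1 / real (Suc n)))"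
proof (intro incseq_SucI)
  fix n
  have "ball x (1 / real (Suc (Suc n))) \<subseteq> ball x (1 / real (Suc n))" for x :: 'a
    by (intro subset_ball) (simp add: field_simps)
  then show "erosion K (1 / real (Suc n)) \<subseteq> erosion K (1 / real (Suc (Suc n)))"
    by (auto simp: erosion_def)
qed

lemma UN_erosion:
  assumes "open K"
  shows "(\<Union>n. erosion K (1 / real (Suc n))) = K"
proof
  show "(\<Union>n. erosion K (1 / real (Suc n))) \<subseteq> K"
    using erosion_subset[of "1 / real (Suc _)" K] by auto
  show "K \<subseteq> (\<Union>n. erosion K (1 / real (Suc n)))"
  proof
    fix x assume "x \<in> K"
    then obtain e where e: "0 < e" "ball x e \<subseteq> K" using assms openE by blast
    obtain n where "1 / real (Suc n) < e" using nat_approx_posE[OF e(1)] by blast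
    then have "ball x (1 / real (Suc n)) \<subseteq> K"
      using e(2) subset_ball[of "1 / real (Suc n)" e x] by auto
    then show "x \<in> (\<Union>n. erosion K (1 / real (Suc n)))" by (auto simp: erosion_def)
  qed
qed

section \<open>The inequality for log-concave probability measures\<close>

lemma integral_density_indicator_eq:
  fixes \<rho> \<phi> :: "'a::euclidean_space \<Rightarrow> real"
  assumes K: "open K" "continuous_on K \<rho>" and L: "compact L" "L \<subseteq> K"
    and \<phi>: "continuous_on L \<phi>"
  shows "(LINT x|density lborel (\<lambda>x. ennreal (indicator L x * exp (- \<rho> x))). indicator L x * \<phi> x)
    = (LINT x|density lborel (\<lambda>x. ennreal (exp (- \<rho> x)) * indicator K x). indicator L x * \<phi> x)"
proof -
  have cont: "continuous_on K (\<lambda>x. exp (- \<rho> x))" "continuous_on L (\<lambda>x. exp (- \<rho> x))"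
    using K L by (auto intro!: continuous_intros intro: continuous_on_subset)
  have [measurable]: "(\<lambda>x. indicator L x * \<phi> x) \<in> borel_measurable borel"
      "(\<lambda>x. indicator L x * exp (- \<rho> x)) \<in> borel_measurable borel"
    using L \<phi> cont by (auto intro: borel_measurable_indicator_continuous)
  have [measurable]: "(\<lambda>x. indicator K x * exp (- \<rho> x)) \<in> borel_measurable borel"
    using borel_measurable_continuous_on_indicator[of K "\<lambda>x. exp (- \<rho> x)"] K cont by simp
  have K_eq: "(\<lambda>x. ennreal (exp (- \<rho> x)) * indicator K x) = (\<lambda>x. ennreal (indicator K x * exp (- \<rho> x)))"
    by (auto simp: indicator_def)
  show ?thesis
    unfolding K_eq using L(2)
    by (subst (1 2) integral_density)
      (auto intro!: Bochner_Integration.integral_cong split: split_indicator)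
qed

text \<open>The restriction of \<open>\<mu>\<close> to \<open>L\<close> is covered by the inequality for compact sets, because a
  smooth function has a Lipschitz gradient there. The measure of \<open>L\<close> stands in
  for the total mass \<open>1\<close>.\<close>

lemma poincare_log_concave_subset:
  fixes f :: "real ^ 'n \<Rightarrow> real"
  assumes \<mu>: "log_concave_with \<mu> K \<rho>" and \<rho>: "continuous_on K \<rho>"
    and f: "smooth_on K f" and R: "0 < R" "\<And>x. x \<in> K \<Longrightarrow> norm x \<le> R"
    and L: "compact L" "convex L" "L \<subseteq> K"
  shows "measure \<mu> L * (LINT x|\<mu>. indicator L x * (f x)\<^sup>2) - (LINT x|\<mu>. indicator L x * f x)\<^sup>2
    \<le> measure \<mu> L * (2 * R\<^sup>2 * (LINT x|\<mu>. indicator L x * (norm (gradient f x))\<^sup>2))"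
proof -
  have K: "open K" "convex K" "convex_on K \<rho>"
    and \<mu>_eq: "\<mu> = density lborel (\<lambda>x. ennreal (exp (- \<rho> x)) * indicator K x)"
    using \<mu> by (auto simp: log_concave_with_def)
  have sub: "continuous_on L \<phi>" if "continuous_on K \<phi>" for \<phi> :: "real ^ 'n \<Rightarrow> 'b::topological_space"
    using that L(3) by (rule continuous_on_subset)
  have cont_f: "continuous_on K f"
    using f by (intro differentiable_imp_continuous_on smooth_on_imp_differentiable)
  have cont_g: "continuous_on K (gradient f)"
    using f K(1) by (rule smooth_on_continuous_gradient)
  obtain M where lip: "M-lipschitz_on L (gradient f)"
    using smooth_on_lipschitz_gradient[OF f K(1) L] by blast
  define N where "N = density lborel (\<lambda>x. ennreal (indicator L x * exp (- \<rho> x)))"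
  have eq: "(LINT x|N. indicator L x * \<phi> x) = (LINT x|\<mu>. indicator L x * \<phi> x)"
    if "continuous_on K \<phi>" for \<phi> :: "real ^ 'n \<Rightarrow> real"
    unfolding N_def \<mu>_eq using K(1) \<rho> L(1,3) sub[OF that] by (rule integral_density_indicator_eq)
  have "L \<in> sets borel" using L(1) by (rule borel_compact)
  then have "measure N L = measure \<mu> L"
    using eq[of "\<lambda>x. 1"] by (simp add: N_def \<mu>_eq)
  moreover have "measure N L * (LINT x|N. indicator L x * (f x)\<^sup>2) - (LINT x|N. indicator L x * f x)\<^sup>2
    \<le> measure N L * (2 * R\<^sup>2 * (LINT x|N. indicator L x * (norm (gradient f x))\<^sup>2))"
    unfolding N_def
  proof (rule poincare_log_concave_compact[OF L(1,2) R(1) _ sub[OF \<rho>]])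
    show "convex_on L \<rho>" using K(3) L by (meson convex_on_subset)
    show "norm x \<le> R" if "x \<in> L" for x using R(2) L(3) that by blast
    show "(f has_derivative (\<lambda>h. gradient f x \<bullet> h)) (at x within L)" if "x \<in> L" for x
      using smooth_on_has_derivative_gradient(1)[OF f K(1)] L(3) that by blast
  qed (fact lip)
  ultimately show ?thesis
    using eq[of f] eq[of "\<lambda>x. (f x)\<^sup>2"] eq[of "\<lambda>x. (norm (gradient f x))\<^sup>2"] cont_f cont_g
    by (simp add: continuous_intros)
qed

theorem corollary1p2:
  fixes \<mu> :: "(real ^ 'n) measure"
    and K :: "(real ^ 'n) set"
    and \<rho> f :: "real ^ 'n \<Rightarrow> real"
  assumes "log_concave_with \<mu> K \<rho>"
    and "barycenter \<mu> = 0"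
    and "bounded K"
    and "smooth_on K \<rho>"
    and "bounded_derivs_on K \<rho>"
    and "smooth_on K f"
    and "set_integrable \<mu> K f"
  shows "enn2ereal (\<integral>\<^sup>+x\<in>K. ennreal ((f x)\<^sup>2) \<partial>\<mu>) - ereal ((LINT x:K|\<mu>. f x)\<^sup>2)
    \<le> ereal (2 * (SUP x\<in>K. norm x)\<^sup>2)
        * enn2ereal (\<integral>\<^sup>+x\<in>K. ennreal ((norm (gradient f x))\<^sup>2) \<partial>\<mu>)"
proof -
  define R where "R = (SUP x\<in>K. norm x)"
  define A where "A = (\<integral>\<^sup>+x\<in>K. ennreal ((f x)\<^sup>2) \<partial>\<mu>)"
  define m where "m = (LINT x:K|\<mu>. f x)"
  define G where "G = (\<integral>\<^sup>+x\<in>K. ennreal ((norm (gradient f x))\<^sup>2) \<partial>\<mu>)"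
  have K: "open K" "convex K"
    and \<mu>_eq: "\<mu> = density lborel (\<lambda>x. ennreal (exp (- \<rho> x)) * indicator K x)"
    using assms(1) by (auto simp: log_concave_with_def)
  interpret prob_space \<mu> using assms(1) unfolding log_concave_with_def by blast
  have sets_\<mu>[simp, measurable_cong]: "sets \<mu> = sets borel" and space_\<mu>[simp]: "space \<mu> = UNIV"
    by (simp_all add: \<mu>_eq)
  have cont_\<rho>: "continuous_on K \<rho>" and cont_f: "continuous_on K f"
    using assms(4,6) by (auto intro: differentiable_imp_continuous_on smooth_on_imp_differentiable)
  have cont_g: "continuous_on K (gradient f)"
    using assms(6) K(1) by (rule smooth_on_continuous_gradient)
  have K_sets[measurable]: "K \<in> sets borel" using K(1) by simp
  have prob_K: "measure \<mu> K = 1"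
  proof -
    have "continuous_on K (\<lambda>x. exp (- \<rho> x))" using cont_\<rho> by (intro continuous_intros)
    then have "(\<lambda>x. indicator K x * exp (- \<rho> x)) \<in> borel_measurable borel"
      using borel_measurable_continuous_on_indicator[of K "\<lambda>x. exp (- \<rho> x)"] by simp
    moreover have "(\<lambda>x. ennreal (exp (- \<rho> x)) * indicator K x) = (\<lambda>x. ennreal (indicator K x * exp (- \<rho> x)))"
      by (auto simp: indicator_def)
    ultimately have [measurable]: "(\<lambda>x. ennreal (exp (- \<rho> x)) * indicator K x) \<in> borel_measurable borel"
      by simp
    have "AE x in \<mu>. x \<in> K"
      unfolding \<mu>_eq by (subst AE_density) (auto split: split_indicator)
    then show ?thesis by (simp add: prob_eq_1)
  qed
  \<comment> \<open>Positivity of \<open>R\<close> matters when the gradient integral is infinite: the right-hand side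
    must then be infinite, not \<open>0 * \<infinity> = 0\<close>.\<close>
  have R: "0 < R" "\<And>x. x \<in> K \<Longrightarrow> norm x \<le> R"
  proof -
    have bdd: "bdd_above (norm ` K)"
      using assms(3) by (auto simp: bounded_iff bdd_above_def)
    then show le: "norm x \<le> R" if "x \<in> K" for x
      unfolding R_def using that by (intro cSUP_upper) auto
    have "K \<noteq> {}" using prob_K by auto
    moreover have "K \<noteq> {0}" using K(1) by (auto simp: not_open_singleton)
    ultimately obtain x where "x \<in> K" "x \<noteq> 0" by auto
    then show "0 < R" using le[of x] by (meson less_le_trans zero_less_norm_iff)
  qed
  show ?thesis
  proof (cases "G = top")
    case True
    then show ?thesis
      using R(1) by (simp add: R_def[symmetric] G_def[symmetric])
  next
    case False
    then obtain r where r: "G = ennreal r" "0 \<le> r" by (cases G) auto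
    define L where "L n = erosion K (1 / real (Suc n))" for n
    have L_sub: "L n \<subseteq> K" for n
      unfolding L_def by (rule erosion_subset) simp
    have L_inc: "incseq L" unfolding L_def by (rule incseq_erosion)
    have L_UN: "(\<Union>n. L n) = K" unfolding L_def by (rule UN_erosion[OF K(1)])
    have L_convex: "convex (L n)" for n unfolding L_def by (rule convex_erosion[OF K(2)])
    have L_compact: "compact (L n)" for n
      using closed_erosion bounded_subset[OF assms(3) L_sub] by (auto simp: compact_eq_bounded_closed L_def)
    have L_sets[measurable]: "L n \<in> sets borel" for n using L_compact by (rule borel_compact)
    have contL: "continuous_on (L n) \<phi>" if "continuous_on K \<phi>" for \<phi> :: "real ^ 'n \<Rightarrow> real" and n
      using that L_sub by (rule continuous_on_subset)
    have nn: "(\<integral>\<^sup>+x\<in>L n. ennreal (\<phi> x) \<partial>\<mu>) = ennreal (LINT x|\<mu>. indicator (L n) x * \<phi> x)"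
      if \<phi>: "continuous_on K \<phi>" "\<And>x. 0 \<le> \<phi> x" for \<phi> :: "real ^ 'n \<Rightarrow> real" and n
    proof -
      obtain B where B: "0 \<le> B" "\<And>x. x \<in> L n \<Longrightarrow> \<bar>\<phi> x\<bar> \<le> B"
        using compact_continuous_bound[OF L_compact contL[OF \<phi>(1)]] by blast
      have "integrable \<mu> (\<lambda>x. indicator (L n) x * \<phi> x)"
        using borel_measurable_indicator_continuous[OF L_compact contL[OF \<phi>(1)], of n]
          bounded_indicator_mult[of "L n" \<phi> B, OF B(2,1)]
        by (intro integrable_const_bound[where B = B]) auto
      then have "(\<integral>\<^sup>+x. ennreal (indicator (L n) x * \<phi> x) \<partial>\<mu>) = ennreal (LINT x|\<mu>. indicator (L n) x * \<phi> x)"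
        using \<phi>(2) by (intro nn_integral_eq_integral) auto
      moreover have "ennreal (indicator (L n) x * \<phi> x) = ennreal (\<phi> x) * indicator (L n) x" for x
        by (simp add: indicator_def)
      ultimately show ?thesis by simp
    qed
    define a where "a n = (LINT x|\<mu>. indicator (L n) x * (f x)\<^sup>2)" for n
    have mass_lim: "(\<lambda>n. measure \<mu> (L n)) \<longlonglongrightarrow> 1"
      using finite_Lim_measure_incseq[of L] L_inc L_UN prob_K by (simp add: image_subset_iff)
    have mean_lim: "(\<lambda>n. LINT x|\<mu>. indicator (L n) x * f x) \<longlonglongrightarrow> m"
    proof -
      have "(\<lambda>n. LINT x:(L n)|\<mu>. f x) \<longlonglongrightarrow> (LINT x:(\<Union>n. L n)|\<mu>. f x)"
        using L_inc assms(7) by (intro set_integral_cont_up) (auto simp: L_UN)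
      then show ?thesis by (simp add: L_UN m_def set_lebesgue_integral_def)
    qed
    have a_lim: "(\<lambda>n. ennreal (a n)) \<longlonglongrightarrow> A"
    proof -
      have "(\<lambda>n. \<integral>\<^sup>+x. ennreal ((f x)\<^sup>2) * indicator (L n) x \<partial>\<mu>) \<longlonglongrightarrow> A"
        unfolding A_def
      proof (rule nn_integral_LIMSEQ)
        show "incseq (\<lambda>n x. ennreal ((f x)\<^sup>2) * indicator (L n) x)"
          using L_inc by (auto simp: incseq_def le_fun_def indicator_def)
        have "(\<lambda>x. indicator (L n) x * (f x)\<^sup>2) \<in> borel_measurable borel" for n
          by (intro borel_measurable_indicator_continuous L_compact contL continuous_intros cont_f)
        then have "(\<lambda>x. ennreal (indicator (L n) x * (f x)\<^sup>2)) \<in> borel_measurable \<mu>" for n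
          by measurable
        then show "(\<lambda>x. ennreal ((f x)\<^sup>2) * indicator (L n) x) \<in> borel_measurable \<mu>" for n
          by (simp add: ennreal_mult' ennreal_indicator mult.commute)
        fix x
        have "(\<lambda>n. indicator (L n) x :: ennreal) \<longlonglongrightarrow> indicator (\<Union>n. L n) x"
          using L_inc by (rule LIMSEQ_indicator_incseq)
        then show "(\<lambda>n. ennreal ((f x)\<^sup>2) * indicator (L n) x) \<longlonglongrightarrow> ennreal ((f x)\<^sup>2) * indicator K x"
          unfolding L_UN by (intro tendsto_mult_ennreal tendsto_const) (auto simp: indicator_def)
      qed
      then show ?thesis unfolding a_def using nn[of "\<lambda>x. (f x)\<^sup>2"] cont_f by (simp add: continuous_intros)
    qed
    have bound: "measure \<mu> (L n) * a n \<le> (LINT x|\<mu>. indicator (L n) x * f x)\<^sup>2 + 2 * R\<^sup>2 * r" for n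
    proof -
      define b where "b = (LINT x|\<mu>. indicator (L n) x * (norm (gradient f x))\<^sup>2)"
      have "ennreal b = (\<integral>\<^sup>+x\<in>L n. ennreal ((norm (gradient f x))\<^sup>2) \<partial>\<mu>)"
        unfolding b_def using cont_g by (intro nn[symmetric] continuous_intros) auto
      also have "\<dots> \<le> G"
        unfolding G_def using L_sub[of n] by (intro nn_integral_mono) (auto simp: indicator_def)
      finally have "b \<le> r" using r by (simp add: ennreal_le_iff)
      have "0 \<le> b" unfolding b_def by (intro integral_nonneg_AE) auto
      have "measure \<mu> (L n) * (2 * R\<^sup>2 * b) \<le> 1 * (2 * R\<^sup>2 * r)"
        using \<open>b \<le> r\<close> \<open>0 \<le> b\<close> by (intro mult_mono) auto
      then show ?thesis
        using poincare_log_concave_subset[OF assms(1) cont_\<rho> assms(6) R L_compact L_convex L_sub, of n]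
        by (simp add: a_def b_def)
    qed
    \<comment> \<open>The limit \<open>A\<close> is not known to be finite yet; multiplication is continuous here because
      the masses converge to \<open>1\<close>, which is not \<open>0\<close>.\<close>
    have "(\<lambda>n. ennreal (measure \<mu> (L n)) * ennreal (a n)) \<longlonglongrightarrow> ennreal 1 * A"
      by (intro tendsto_mult_ennreal tendsto_ennrealI mass_lim a_lim) auto
    then have lhs: "(\<lambda>n. ennreal (measure \<mu> (L n) * a n)) \<longlonglongrightarrow> A"
      by (simp add: ennreal_mult')
    have rhs: "(\<lambda>n. ennreal ((LINT x|\<mu>. indicator (L n) x * f x)\<^sup>2 + 2 * R\<^sup>2 * r))
        \<longlonglongrightarrow> ennreal (m\<^sup>2 + 2 * R\<^sup>2 * r)"
      by (intro tendsto_intros mean_lim)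
    have le: "A \<le> ennreal (m\<^sup>2 + 2 * R\<^sup>2 * r)"
      using bound by (intro LIMSEQ_le[OF lhs rhs]) (auto intro: ennreal_leI)
    then obtain \<alpha> where \<alpha>: "A = ennreal \<alpha>" "0 \<le> \<alpha>" by (cases A) (auto simp: top_unique)
    have "\<alpha> \<le> m\<^sup>2 + 2 * R\<^sup>2 * r"
      using le r unfolding \<alpha>(1) by (subst (asm) ennreal_le_iff) auto
    then have "\<alpha> - m\<^sup>2 \<le> 2 * R\<^sup>2 * r"
      by simp
    then show ?thesis
      using \<alpha> r by (simp add: A_def[symmetric] G_def[symmetric] m_def[symmetric] R_def[symmetric])
  qed
qed

end
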